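(* For all $n\ge 1$ and $i\in\{1,2\}$, $s_i(n,\# P_4,S_4)\ge n-3$. Moreover: for $n=1,2,3,4,5$: $s_1(n,\# P_4,S_4)$ equals $n-1,\ n-2,\ n-3,\ n$ for $n=1,2,3,4$ and $s_1(5,\# P_4,S_4)\le 5-1$; $s_2(n,\# P_4,S_4)$ equals $n-1,\ n-2,\ n-3,\ n,\ n$ for $n=1,2,3,4,5$. For every integer $k\ge 0$: if $n=4k+6$, then $s_1(n,\# P_4,S_4)\le n-2$ and $s_2(n,\# P_4,S_4)\le n-1$; if $n=4k+7$, then $s_1(n,\# P_4,S_4)=s_2(n,\# P_4,S_4)=n-3$; if $n=4k+8$, then $s_1(n,\# P_4,S_4)\le n-2$ and $s_2(n,\# P_4,S_4)\le n-1$; if $n=4k+9$, then $s_1(n,\# P_4,S_4)\le n-1$ and $s_2(n,\# P_4,S_4)\le n-2$.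
   Context: For graphs $F$ and $H$, the $F$-saturation game on $n$ vertices is played by Max and Mini, who alternately claim previously unclaimed edges of $K_n$ so that the graph $G$ of claimed edges stays $F$-free; the game ends when $G$ is $F$-saturated. The $H$-score is the number of (not necessarily induced) subgraphs of the final $G$ isomorphic to $H$. Max maximizes, Mini minimizes the score; $s_1(n,\# H,F)$ is the optimal score when Max starts, $s_2(n,\# H,F)$ when Mini starts. $P_4$ is the path on 4 vertices and $S_4$ the star on 4 vertices (so the game graph must keep maximum degree at most 2). *)

theory Defs
  imports Complex_Main "HOL-Library.Ramsey"
begin

type_synonym 'a graph = "'a set \<times> 'a set set"

abbreviation verts :: "'a graph \<Rightarrow> 'a set" where "verts \<equiv> fst"
abbreviation edges :: "'a graph \<Rightarrow> 'a set set" where "edges \<equiv> snd"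

definition simple_graph :: "'a graph \<Rightarrow> bool" where
  "simple_graph G \<longleftrightarrow> edges G \<subseteq> [verts G]\<^bsup>2\<^esup>"

definition subgraph :: "'a graph \<Rightarrow> 'a graph \<Rightarrow> bool" where
  "subgraph H G \<longleftrightarrow> simple_graph H \<and> verts H \<subseteq> verts G \<and> edges H \<subseteq> edges G"

text \<open>Meant for simple graphs, where every edge is a subset of the vertex set.\<close>
definition isomorphic :: "'a graph \<Rightarrow> 'b graph \<Rightarrow> bool" where
  "isomorphic G H \<longleftrightarrow>
     (\<exists>f. bij_betw f (verts G) (verts H) \<and> edges H = (\<lambda>e. f ` e) ` edges G)"

text \<open>The not necessarily induced copies of \<open>H\<close> in \<open>G\<close>.\<close>
definition copies :: "'b graph \<Rightarrow> 'a graph \<Rightarrow> 'a graph set" where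
  "copies H G = {H'. subgraph H' G \<and> isomorphic H' H}"

definition score :: "'b graph \<Rightarrow> 'a graph \<Rightarrow> nat" where
  "score H G = card (copies H G)"

definition free :: "'c graph \<Rightarrow> 'a graph \<Rightarrow> bool" where
  "free F G \<longleftrightarrow> copies F G = {}"

definition add_edge :: "'a graph \<Rightarrow> 'a set \<Rightarrow> 'a graph" where
  "add_edge G e = (verts G, insert e (edges G))"

definition saturated :: "'c graph \<Rightarrow> 'a graph \<Rightarrow> bool" where
  "saturated F G \<longleftrightarrow> free F G \<and> (\<forall>e \<in> [verts G]\<^bsup>2\<^esup> - edges G. \<not> free F (add_edge G e))"

text \<open>The edges that may be claimed at position \<open>G\<close>.\<close>
definition moves :: "'c graph \<Rightarrow> 'a graph \<Rightarrow> 'a set set" where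
  "moves F G = {e \<in> [verts G]\<^bsup>2\<^esup> - edges G. free F (add_edge G e)}"

datatype player = Maxi | Mini

text \<open>
  The value, under optimal play (backward induction), of the game on the vertex set
  \<open>{..<n}\<close> when the edges in \<open>E\<close> have been claimed and the given player is to move.
  Every position reached from an \<open>F\<close>-free one is \<open>F\<close>-free, and an \<open>F\<close>-free position that
  is not \<open>F\<close>-saturated has a move, so \<open>Max\<close> and \<open>Min\<close> are then taken over finite
  nonempty sets.
\<close>
function game_value :: "'c graph \<Rightarrow> 'b graph \<Rightarrow> nat \<Rightarrow> player \<Rightarrow> nat set set \<Rightarrow> nat" where
  "game_value F H n p E =
     (if saturated F ({..<n}, E) then score H ({..<n}, E)
      else (case p of
        Maxi \<Rightarrow> Max ((\<lambda>e. game_value F H n Mini (insert e E)) ` moves F ({..<n}, E))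
      | Mini \<Rightarrow> Min ((\<lambda>e. game_value F H n Maxi (insert e E)) ` moves F ({..<n}, E))))"
  by pat_completeness auto

lemma remaining_edges_decrease:
  assumes "e \<in> moves F ({..<n}, E)"
  shows "card ([{..<n}]\<^bsup>2\<^esup> - insert e E) < card ([{..<n::nat}]\<^bsup>2\<^esup> - E)"
  using assms by (intro psubset_card_mono) (auto simp: moves_def finite_imp_finite_nsets)

termination
  by (relation "measure (\<lambda>(F, H, n, p, E). card ([{..<n}]\<^bsup>2\<^esup> - E))")
    (auto simp: remaining_edges_decrease)

declare game_value.simps [simp del]

text \<open>The optimal scores \<open>s\<^sub>1(n, #H, F)\<close> (Max starts) and \<open>s\<^sub>2(n, #H, F)\<close> (Mini starts).\<close>
definition s\<^sub>1 :: "nat \<Rightarrow> 'b graph \<Rightarrow> 'c graph \<Rightarrow> nat" where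
  "s\<^sub>1 n H F = game_value F H n Maxi {}"

definition s\<^sub>2 :: "nat \<Rightarrow> 'b graph \<Rightarrow> 'c graph \<Rightarrow> nat" where
  "s\<^sub>2 n H F = game_value F H n Mini {}"

text \<open>The index counts vertices: \<open>star_graph k\<close> has \<open>k - 1\<close> leaves.\<close>
definition path_graph :: "nat \<Rightarrow> nat graph" where
  "path_graph k = ({..<k}, {{i, Suc i} | i. Suc i < k})"

definition star_graph :: "nat \<Rightarrow> nat graph" where
  "star_graph k = ({..<k}, {{0, i} | i. 0 < i \<and> i < k})"

abbreviation P\<^sub>4 :: "nat graph" where "P\<^sub>4 \<equiv> path_graph 4"
abbreviation S\<^sub>4 :: "nat graph" where "S\<^sub>4 \<equiv> star_graph 4"

end

(*
  A graph of maximum degree at most two is a disjoint union of paths and cycles, and a move joins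
  two paths or closes a path with at least three vertices into a cycle.  The game ends when at most
  one path is left and that path has at most two vertices.  A cycle of length m >= 4 contains m
  copies of P_4 and a triangle none, so the final score is n - 3 t - r, where t is the number of
  triangles and r is the number of vertices outside the cycles.  Hence only the number i of isolated
  vertices, the numbers e and p of paths with two and with three vertices, the number q of longer
  paths and t matter, and the problem is a game on the tuples (i, e, p, q, t).

  Max can keep p = 0 after each of his moves until the very end, which bounds the loss 3 t + r by 3.
  Mini creates a triangle as soon as Max leaves her a path on three vertices, so Max has to remove
  every such path that she creates; with at most one long path on the board, the position then stays
  within a few families described by i mod 4.
*)
theory Submission
  imports Defs "HOL-Library.Multiset"
begin

subsection \<open>Copies of stars and paths\<close>

text \<open>The isomorphism in the definition runs from the copy to \<open>H\<close>; inverting it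
  on the vertices gives an embedding of \<open>H\<close>, and conversely. Questions about copies
  thus become questions about vertex tuples.\<close>

lemma copies_eq:
  assumes "simple_graph H"
  shows "copies H G = {(g ` verts H, (`) g ` edges H) |g.
    inj_on g (verts H) \<and> g ` verts H \<subseteq> verts G \<and> (`) g ` edges H \<subseteq> edges G}"
    (is "_ = ?R")
proof (intro equalityI subsetI)
  fix K assume "K \<in> copies H G"
  then obtain f where K: "simple_graph K" "verts K \<subseteq> verts G" "edges K \<subseteq> edges G"
    and f: "bij_betw f (verts K) (verts H)" "edges H = (`) f ` edges K"
    by (auto simp: copies_def subgraph_def isomorphic_def)
  define g where "g = inv_into (verts K) f"
  have g: "bij_betw g (verts H) (verts K)"
    unfolding g_def using f(1) by (rule bij_betw_inv_into)
  have "g ` f ` e = e" if "e \<in> edges K" for e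
  proof -
    have "e \<subseteq> verts K" using K(1) that by (auto simp: simple_graph_def nsets_def)
    then show ?thesis unfolding g_def using f(1) by (simp add: bij_betw_def inv_into_image_cancel)
  qed
  then have "(`) g ` edges H = edges K" using f(2) by (force simp: image_image)
  with g K show "K \<in> ?R"
    by (auto simp: bij_betw_def intro!: exI[of _ g] prod_eqI)
next
  fix K assume "K \<in> ?R"
  then obtain g where K: "K = (g ` verts H, (`) g ` edges H)"
    and g: "inj_on g (verts H)" "g ` verts H \<subseteq> verts G" "(`) g ` edges H \<subseteq> edges G"
    by blast
  define f where "f = inv_into (verts H) g"
  have f: "bij_betw f (verts K) (verts H)"
    unfolding f_def K using g(1) by (simp add: bij_betw_inv_into inj_on_imp_bij_betw)
  have sub: "e \<subseteq> verts H" if "e \<in> edges H" for e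
    using assms that by (auto simp: simple_graph_def nsets_def)
  have "f ` g ` e = e" if "e \<in> edges H" for e
    unfolding f_def using g(1) sub[OF that] by (simp add: inv_into_image_cancel)
  then have "edges H = (`) f ` edges K" by (force simp: K image_image)
  moreover have "simple_graph K"
    using assms g(1) sub
    by (auto simp: simple_graph_def nsets_def K card_image inj_on_subset finite_subset)
  ultimately show "K \<in> copies H G"
    using f g K by (auto simp: copies_def subgraph_def isomorphic_def)
qed

lemma edges_P4: "edges P\<^sub>4 = {{0, 1}, {1, 2}, {2, 3}}"
proof -
  have "Suc i < 4 \<longleftrightarrow> i = 0 \<or> i = 1 \<or> i = 2" for i by auto
  then show ?thesis by (auto simp: path_graph_def numeral_eq_Suc)
qed

lemma edges_S4: "edges S\<^sub>4 = {{0, 1}, {0, 2}, {0, 3}}"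
proof -
  have "0 < i \<and> i < 4 \<longleftrightarrow> i = 1 \<or> i = 2 \<or> i = 3" for i :: nat by auto
  then show ?thesis by (auto simp: star_graph_def)
qed

lemma lessThan_4: "{..<4} = {0, 1, 2, 3::nat}" by auto

lemma verts_P4: "verts P\<^sub>4 = {0, 1, 2, 3}" by (simp add: path_graph_def lessThan_4)
lemma verts_S4: "verts S\<^sub>4 = {0, 1, 2, 3}" by (simp add: star_graph_def lessThan_4)

lemma simple_P4: "simple_graph P\<^sub>4"
  by (simp add: simple_graph_def edges_P4 verts_P4 nsets_def)
lemma simple_S4: "simple_graph S\<^sub>4"
  by (simp add: simple_graph_def edges_S4 verts_S4 nsets_def)

lemma ex_image_0123:
  "(\<exists>g :: nat \<Rightarrow> 'a. P (g 0) (g 1) (g 2) (g 3)) \<longleftrightarrow> (\<exists>a b c d. P a b c d)"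
proof
  assume "\<exists>a b c d. P a b c d"
  then obtain a b c d where "P a b c d" by blast
  then show "\<exists>g :: nat \<Rightarrow> 'a. P (g 0) (g 1) (g 2) (g 3)"
    by (intro exI[of _ "\<lambda>i. [a, b, c, d] ! i"]) (simp add: numeral_eq_Suc)
qed blast

lemma inj_on_0123: "inj_on g {0, 1, 2, 3 :: nat} \<longleftrightarrow> distinct [g 0, g 1, g 2, g 3]"
  by (auto simp: inj_on_def)

text \<open>No ambient vertex set occurs, so the copies in a whole graph and those in a single cycle
  can be compared directly.\<close>

definition P4s :: "'a set set \<Rightarrow> 'a graph set" where
  "P4s E = {({a, b, c, d}, {{a, b}, {b, c}, {c, d}}) |a b c d.
    distinct [a, b, c, d] \<and> {a, b} \<in> E \<and> {b, c} \<in> E \<and> {c, d} \<in> E}"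

lemma P4sE:
  assumes "K \<in> P4s E"
  obtains a b c d where "K = ({a, b, c, d}, {{a, b}, {b, c}, {c, d}})" "distinct [a, b, c, d]"
    "{a, b} \<in> E" "{b, c} \<in> E" "{c, d} \<in> E"
  using assms unfolding P4s_def mem_Collect_eq by (elim exE conjE) (rule that)

lemma P4sI:
  assumes "distinct [a, b, c, d]" "{a, b} \<in> E" "{b, c} \<in> E" "{c, d} \<in> E"
  shows "({a, b, c, d}, {{a, b}, {b, c}, {c, d}}) \<in> P4s E"
  unfolding P4s_def mem_Collect_eq
  by (rule exI[of _ a], rule exI[of _ b], rule exI[of _ c], rule exI[of _ d])
    (intro conjI refl assms)

lemma copies_P4:
  assumes "E \<subseteq> [V]\<^bsup>2\<^esup>"
  shows "copies P\<^sub>4 (V, E) = P4s E"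
proof -
  have sub: "\<And>e. e \<in> E \<Longrightarrow> e \<subseteq> V" using assms by (auto simp: nsets_def)
  define Q where "Q K a b c d \<longleftrightarrow> K = ({a, b, c, d}, {{a, b}, {b, c}, {c, d}}) \<and>
     distinct [a, b, c, d] \<and> {a, b, c, d} \<subseteq> V \<and> {{a, b}, {b, c}, {c, d}} \<subseteq> E" for K a b c d
  have "K \<in> copies P\<^sub>4 (V, E) \<longleftrightarrow> (\<exists>g :: nat \<Rightarrow> _. Q K (g 0) (g 1) (g 2) (g 3))" for K
    unfolding copies_eq[OF simple_P4] edges_P4 verts_P4 inj_on_0123 Q_def
    by (simp only: mem_Collect_eq image_insert image_empty fst_conv snd_conv)
  then have "K \<in> copies P\<^sub>4 (V, E) \<longleftrightarrow> (\<exists>a b c d. Q K a b c d)" for K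
    by (simp only: ex_image_0123[of "Q K"])
  moreover have "Q K a b c d \<longleftrightarrow> K = ({a, b, c, d}, {{a, b}, {b, c}, {c, d}}) \<and>
      distinct [a, b, c, d] \<and> {a, b} \<in> E \<and> {b, c} \<in> E \<and> {c, d} \<in> E" for K a b c d
    using sub[of "{a, b}"] sub[of "{c, d}"] by (auto simp: Q_def)
  ultimately show ?thesis by (intro set_eqI) (simp only: P4s_def mem_Collect_eq)
qed

lemma free_S4:
  assumes "E \<subseteq> [V]\<^bsup>2\<^esup>"
  shows "free S\<^sub>4 (V, E) \<longleftrightarrow>
    \<not> (\<exists>v a b c. distinct [a, b, c] \<and> {v, a} \<in> E \<and> {v, b} \<in> E \<and> {v, c} \<in> E)"
proof -
  have sub: "\<And>e. e \<in> E \<Longrightarrow> e \<subseteq> V" using assms by (auto simp: nsets_def)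
  \<comment> \<open>Without loops the centre of a star differs from its leaves, so only the leaves
    have to be required distinct.\<close>
  have ne: "\<And>v. {v} \<notin> E" using assms by (auto simp: nsets_def)
  define Q where "Q K v a b c \<longleftrightarrow> K = ({v, a, b, c}, {{v, a}, {v, b}, {v, c}}) \<and>
     distinct [v, a, b, c] \<and> {v, a, b, c} \<subseteq> V \<and> {{v, a}, {v, b}, {v, c}} \<subseteq> E" for K v a b c
  have "K \<in> copies S\<^sub>4 (V, E) \<longleftrightarrow> (\<exists>g :: nat \<Rightarrow> _. Q K (g 0) (g 1) (g 2) (g 3))" for K
    unfolding copies_eq[OF simple_S4] edges_S4 verts_S4 inj_on_0123 Q_def
    by (simp only: mem_Collect_eq image_insert image_empty fst_conv snd_conv)
  then have "K \<in> copies S\<^sub>4 (V, E) \<longleftrightarrow> (\<exists>v a b c. Q K v a b c)" for K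
    by (simp only: ex_image_0123[of "Q K"])
  then have "free S\<^sub>4 (V, E) \<longleftrightarrow> (\<nexists>K v a b c. Q K v a b c)"
    by (auto simp: free_def)
  moreover have "Q ({v, a, b, c}, {{v, a}, {v, b}, {v, c}}) v a b c"
    if "distinct [a, b, c]" "{v, a} \<in> E" "{v, b} \<in> E" "{v, c} \<in> E" for v a b c
    using that sub[of "{v, a}"] sub[of "{v, b}"] sub[of "{v, c}"] ne[of v] by (auto simp: Q_def)
  moreover have "distinct [a, b, c] \<and> {v, a} \<in> E \<and> {v, b} \<in> E \<and> {v, c} \<in> E"
    if "Q K v a b c" for K v a b c
    using that by (simp add: Q_def)
  ultimately show ?thesis by blast
qed

subsection \<open>Paths and cycles\<close>

fun pedges :: "'a list \<Rightarrow> 'a set set" where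
  "pedges (x # y # xs) = insert {x, y} (pedges (y # xs))"
| "pedges _ = {}"

text \<open>This is a cycle only from length three on; on two vertices the closing edge is the path
  edge itself.\<close>

definition cedges :: "'a list \<Rightarrow> 'a set set" where
  "cedges xs = insert {hd xs, last xs} (pedges xs)"

lemma pedges_append:
  "xs \<noteq> [] \<Longrightarrow> ys \<noteq> [] \<Longrightarrow> pedges (xs @ ys) = insert {last xs, hd ys} (pedges xs \<union> pedges ys)"
proof (induction xs rule: pedges.induct)
  case ("2_2" v)
  then show ?case by (cases ys) auto
qed auto

lemma pedges_rev [simp]: "pedges (rev xs) = pedges xs"
proof (induction xs rule: pedges.induct)
  case (1 x y xs)
  then have "pedges (rev xs @ [y]) = pedges (y # xs)" by simp
  then have "pedges ((rev xs @ [y]) @ [x]) = insert {x, y} (pedges (y # xs))"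
    by (subst pedges_append) (auto simp: insert_commute)
  then show ?case by simp
qed auto

lemma pedges_nsets: "distinct xs \<Longrightarrow> pedges xs \<subseteq> [set xs]\<^bsup>2\<^esup>"
  by (induction xs rule: pedges.induct) (auto simp: nsets_def card_insert_if)

lemma cedges_nsets: "distinct xs \<Longrightarrow> 3 \<le> length xs \<Longrightarrow> cedges xs \<subseteq> [set xs]\<^bsup>2\<^esup>"
proof -
  assume a: "distinct xs" "3 \<le> length xs"
  then have "{hd xs, last xs} \<in> [set xs]\<^bsup>2\<^esup>"
    by (cases xs) (auto simp: nsets_def card_insert_if)
  with a show ?thesis using pedges_nsets[of xs] by (auto simp: cedges_def)
qed

text \<open>Degrees are read off from this form: an inner vertex of a path has two neighbours, an
  end at most one.\<close>

lemma pedges_nbrs: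
  assumes "distinct (xs @ v # ys)"
  shows "{v, w} \<in> pedges (xs @ v # ys) \<longleftrightarrow> xs \<noteq> [] \<and> w = last xs \<or> ys \<noteq> [] \<and> w = hd ys"
proof -
  have out: "{v, w} \<notin> pedges zs" if "v \<notin> set zs" "distinct zs" for zs
    using pedges_nsets[OF that(2)] that(1) by (auto simp: nsets_def)
  have r: "{v, w} \<in> pedges (v # ys) \<longleftrightarrow> ys \<noteq> [] \<and> w = hd ys"
    using assms out[of ys] by (cases ys) (auto simp: doubleton_eq_iff)
  show ?thesis
  proof (cases "xs = []")
    case False
    then show ?thesis using assms out[of xs] r
      by (auto simp: pedges_append doubleton_eq_iff)
  qed (simp add: r)
qed

text \<open>The list of a cycle may start anywhere, so neighbours need to be found only for a first
  entry.\<close>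

lemma cedges_rotate: "cedges (xs @ ys) = cedges (ys @ xs)"
  by (cases "xs = []"; cases "ys = []")
    (auto simp: cedges_def pedges_append insert_commute)

lemma cedges_nbrs:
  assumes "distinct (v # ys)" "2 \<le> length ys"
  shows "{v, w} \<in> cedges (v # ys) \<longleftrightarrow> w = hd ys \<or> w = last ys"
  using pedges_nbrs[of "[]" v ys w] assms by (auto simp: cedges_def doubleton_eq_iff)

section \<open>Counting the copies of P_4 in a long cycle\<close>

lemma pedges_nth: "pedges xs = {{xs ! k, xs ! Suc k} |k. Suc k < length xs}"
proof (induction xs rule: pedges.induct)
  case (1 x y xs)
  have "Suc k < length (x # y # xs) \<longleftrightarrow> k = 0 \<or> (\<exists>j. k = Suc j \<and> Suc j < length (y # xs))" for k
    by (cases k) auto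
  then have "{f k |k. Suc k < length (x # y # xs)} = insert (f 0) {f (Suc k) |k. Suc k < length (y # xs)}"
    for f :: "nat \<Rightarrow> 'a set"
    by (simp only:) blast
  with 1 show ?case by simp
qed auto

text \<open>Orient each edge from \<open>x\<close> to \<open>\<sigma> x\<close>. Consecutive edges
  of a path cannot meet head to head, as \<sigma> is injective, nor tail to tail, as it is a
  function. So every P_4 runs along the orientation and is determined by its first vertex. The
  distinctness hypothesis rules out orbits of length below four.\<close>

lemma card_P4s_successor:
  assumes inj: "inj_on \<sigma> D" and closed: "\<And>x. x \<in> D \<Longrightarrow> \<sigma> x \<in> D"
    and dist: "\<And>x. x \<in> D \<Longrightarrow> distinct [x, \<sigma> x, \<sigma> (\<sigma> x), \<sigma> (\<sigma> (\<sigma> x))]"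
  shows "card (P4s ((\<lambda>x. {x, \<sigma> x}) ` D)) = card D"
proof -
  let ?E = "(\<lambda>x. {x, \<sigma> x}) ` D"
  let ?P = "\<lambda>x. ({x, \<sigma> x, \<sigma> (\<sigma> x), \<sigma> (\<sigma> (\<sigma> x))},
    {{x, \<sigma> x}, {\<sigma> x, \<sigma> (\<sigma> x)}, {\<sigma> (\<sigma> x), \<sigma> (\<sigma> (\<sigma> x))}})"
  have edge: "x \<in> D \<and> y \<in> D \<and> (y = \<sigma> x \<or> x = \<sigma> y)" if "{x, y} \<in> ?E" for x y
  proof -
    from that obtain z where "z \<in> D" "{x, y} = {z, \<sigma> z}" by blast
    then show ?thesis using closed by (auto simp: doubleton_eq_iff)
  qed
  have "P4s ?E \<subseteq> ?P ` D"
  proof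
    fix K assume "K \<in> P4s ?E"
    then obtain a b c d where K: "K = ({a, b, c, d}, {{a, b}, {b, c}, {c, d}})"
      and abcd: "distinct [a, b, c, d]" "{a, b} \<in> ?E" "{b, c} \<in> ?E" "{c, d} \<in> ?E"
      by (elim P4sE)
    have D: "{a, b, c, d} \<subseteq> D"
      using edge[OF abcd(2)] edge[OF abcd(4)] by simp
    then have "\<sigma> a = \<sigma> c \<longleftrightarrow> a = c" "\<sigma> b = \<sigma> d \<longleftrightarrow> b = d"
      using inj by (simp_all add: inj_on_eq_iff)
    then have "b = \<sigma> a \<and> c = \<sigma> b \<and> d = \<sigma> c \<or> c = \<sigma> d \<and> b = \<sigma> c \<and> a = \<sigma> b"
      using edge[OF abcd(2)] edge[OF abcd(3)] edge[OF abcd(4)] abcd(1) by fastforce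
    then show "K \<in> ?P ` D"
    proof (elim disjE)
      assume "c = \<sigma> d \<and> b = \<sigma> c \<and> a = \<sigma> b"
      then have "K = ?P d" by (auto simp: K)
      with D show ?thesis by blast
    qed (use D in \<open>auto simp: K\<close>)
  qed
  moreover have "?P x \<in> P4s ?E" if "x \<in> D" for x
    using dist[OF that] closed that by (intro P4sI imageI) auto
  moreover have "inj_on ?P D"
  proof
    fix x y assume x: "x \<in> D" and y: "y \<in> D" and eq: "?P x = ?P y"
    \<comment> \<open>The vertices do not identify a copy, since in a 4-cycle all copies share them.
      The two end vertices, those on exactly one edge, are recovered from the edge set
      instead.\<close>
    have ends: "{z. \<exists>!e. e \<in> {{a, b}, {b, c}, {c, d}} \<and> z \<in> e} = {a, d}" if "distinct [a, b, c, d]"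
      for a b c d :: 'a
      using that by (auto simp: doubleton_eq_iff)
    have "{x, \<sigma> (\<sigma> (\<sigma> x))} = {y, \<sigma> (\<sigma> (\<sigma> y))}"
      unfolding ends[OF dist[OF x], symmetric] ends[OF dist[OF y], symmetric]
      using eq by (simp only: prod.inject)
    then consider "x = y" | "x = \<sigma> (\<sigma> (\<sigma> y))" "y = \<sigma> (\<sigma> (\<sigma> x))"
      by (auto simp: doubleton_eq_iff)
    then show "x = y"
    proof cases
      \<comment> \<open>Now \<open>x\<close> is also the last vertex of the path from
        \<open>y\<close>, so its only edge there leads back to \<open>\<sigma> (\<sigma> y)\<close>.
        Hence \<open>\<sigma> x\<close> is that vertex, and injectivity places \<open>x\<close> at
        \<open>\<sigma> y\<close>, too early on the path.\<close>
      case 2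
      have "{x, \<sigma> x} \<in> snd (?P y)" unfolding eq[symmetric] by simp
      then have "{x, \<sigma> x} \<in> {{y, \<sigma> y}, {\<sigma> y, \<sigma> (\<sigma> y)}, {\<sigma> (\<sigma> y), x}}"
        by (simp only: snd_conv 2(1)[symmetric])
      moreover have "x \<notin> {y, \<sigma> y, \<sigma> (\<sigma> y)}" using dist[OF y] 2(1) by auto
      ultimately have "\<sigma> x = \<sigma> (\<sigma> y)" unfolding insert_iff empty_iff doubleton_eq_iff by blast
      then have "x = \<sigma> y" using inj x closed[OF y] by (auto dest: inj_onD)
      moreover have "\<sigma> y \<noteq> \<sigma> (\<sigma> (\<sigma> y))" using dist[OF y] by simp
      ultimately show ?thesis using 2(1) by metis
    qed
  qed
  ultimately have "bij_betw ?P D (P4s ?E)" by (auto simp: bij_betw_def)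
  then show ?thesis by (simp add: bij_betw_same_card)
qed

lemma card_P4s_cedges:
  assumes xs: "distinct xs" and m: "4 \<le> length xs"
  shows "card (P4s (cedges xs)) = length xs"
proof -
  define m where "m = length xs"
  \<comment> \<open>The cyclic shift: look up the index of \<open>x\<close>, which is unique as the
    entries are distinct, and take the next entry modulo the length.\<close>
  define \<sigma> where "\<sigma> x = xs ! (Suc (the_inv_into {..<m} ((!) xs) x) mod m)" for x
  have inj: "inj_on ((!) xs) {..<m}" using xs by (auto simp: m_def inj_on_nth)
  have set: "set xs = (!) xs ` {..<m}" by (auto simp: m_def set_conv_nth)
  have m4: "4 \<le> m" using m by (simp add: m_def)
  have \<sigma>: "\<sigma> (xs ! k) = xs ! (Suc k mod m)" if "k < m" for k
    using inj that by (simp add: \<sigma>_def the_inv_into_f_f)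
  have nth_eq: "xs ! j = xs ! k \<longleftrightarrow> j = k" if "j < m" "k < m" for j k
    using xs that by (simp add: m_def nth_eq_iff_index_eq)
  have "(\<lambda>x. {x, \<sigma> x}) ` set xs = (\<lambda>k. {xs ! k, xs ! (Suc k mod m)}) ` {..<m}"
    unfolding set by (auto simp: \<sigma> image_image)
  \<comment> \<open>The last index supplies the closing edge, the others the edges of the
    path.\<close>
  also have "{..<m} = insert (m - 1) {k. Suc k < m}" using m4 by auto
  also have "(\<lambda>k. {xs ! k, xs ! (Suc k mod m)}) ` \<dots> = insert {xs ! (m - 1), xs ! 0} (pedges xs)"
    using m4 by (auto simp: pedges_nth m_def[symmetric])
  also have "\<dots> = cedges xs"
    using m4 by (simp add: cedges_def hd_conv_nth last_conv_nth m_def insert_commute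
      flip: length_greater_0_conv)
  finally have eq: "(\<lambda>x. {x, \<sigma> x}) ` set xs = cedges xs" .
  have "card (P4s ((\<lambda>x. {x, \<sigma> x}) ` set xs)) = card (set xs)"
  proof (rule card_P4s_successor)
    show "inj_on \<sigma> (set xs)"
      unfolding set using m4
      by (intro inj_onI) (auto simp: \<sigma> nth_eq mod_Suc split: if_splits)
    show "\<sigma> x \<in> set xs" if "x \<in> set xs" for x
      using that m4 unfolding set by (auto simp: \<sigma>)
    show "distinct [x, \<sigma> x, \<sigma> (\<sigma> x), \<sigma> (\<sigma> (\<sigma> x))]" if "x \<in> set xs" for x
      using that m4 unfolding set by (auto simp: \<sigma> nth_eq mod_Suc split: if_splits)
  qed
  then show ?thesis by (simp add: eq xs distinct_card)
qed

subsection \<open>Positions\<close>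

text \<open>The claimed edges are those of the paths \<open>ps\<close> and the cycles \<open>cs\<close>, which partition the
  vertices; an isolated vertex is a path of length one.\<close>
definition config :: "nat \<Rightarrow> nat list list \<Rightarrow> nat list list \<Rightarrow> nat set set \<Rightarrow> bool" where
  "config n ps cs E \<longleftrightarrow> [] \<notin> set ps \<and> (\<forall>c\<in>set cs. 3 \<le> length c) \<and>
     distinct (concat (ps @ cs)) \<and> set (concat (ps @ cs)) = {..<n} \<and>
     E = \<Union> (pedges ` set ps) \<union> \<Union> (cedges ` set cs)"

text \<open>The moves below act on the front of the list of paths; this brings any chosen path
  there.\<close>

lemma config_perm:
  assumes "mset ps = mset ps'"
  shows "config n ps cs E \<longleftrightarrow> config n ps' cs E"
proof -
  have "mset (concat (ps @ cs)) = mset (concat (ps' @ cs))"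
    using assms by (simp add: mset_concat sum_mset_sum_list[symmetric])
  then have "distinct (concat (ps @ cs)) \<longleftrightarrow> distinct (concat (ps' @ cs))"
    by (rule mset_eq_imp_distinct_iff)
  moreover have "set ps = set ps'" using assms by (rule mset_eq_setD)
  ultimately show ?thesis by (simp add: config_def)
qed

lemma config_rev: "config n (p # ps) cs E \<Longrightarrow> config n (rev p # ps) cs E"
  by (auto simp: config_def)

text \<open>With reversal and permutation, gluing a last vertex to a first one covers every edge
  between ends of different paths.\<close>

lemma config_join:
  "config n (p # q # ps) cs E \<Longrightarrow> config n ((p @ q) # ps) cs (insert {last p, hd q} E)"
  by (auto simp: config_def pedges_append)

lemma config_close:
  "config n (p # ps) cs E \<Longrightarrow> 3 \<le> length p \<Longrightarrow> config n ps (p # cs) (insert {hd p, last p} E)"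
  by (auto simp: config_def cedges_def)

lemma config_empty: "config n (map (\<lambda>v. [v]) [0..<n]) [] {}"
  by (auto simp: config_def comp_def)

lemma config_distinct: "config n ps cs E \<Longrightarrow> xs \<in> set (ps @ cs) \<Longrightarrow> distinct xs"
  unfolding config_def distinct_concat_iff by blast

lemma config_nsets:
  assumes "config n ps cs E"
  shows "E \<subseteq> [{..<n}]\<^bsup>2\<^esup>"
proof -
  have "pedges p \<subseteq> [{..<n}]\<^bsup>2\<^esup>" if "p \<in> set ps" for p
  proof -
    have "set p \<subseteq> {..<n}" using assms that by (auto simp: config_def)
    then show ?thesis using pedges_nsets[OF config_distinct[OF assms], of p] that nsets_mono by fastforce
  qed
  moreover have "cedges c \<subseteq> [{..<n}]\<^bsup>2\<^esup>" if "c \<in> set cs" for c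
  proof -
    have "set c \<subseteq> {..<n}" "3 \<le> length c" using assms that by (auto simp: config_def)
    then show ?thesis using cedges_nsets[OF config_distinct[OF assms], of c] that nsets_mono by fastforce
  qed
  ultimately show ?thesis using assms unfolding config_def by blast
qed

section \<open>Neighbours of a vertex in a position\<close>

lemma config_disjoint:
  assumes "config n ps cs E" "xs \<in> set (ps @ cs)" "ys \<in> set (ps @ cs)" "v \<in> set xs" "v \<in> set ys"
  shows "xs = ys"
  using assms unfolding config_def distinct_concat_iff by blast

lemma config_Int: "config n ps cs E \<Longrightarrow> set ps \<inter> set cs = {}"
proof (rule ccontr)
  assume c: "config n ps cs E" "set ps \<inter> set cs \<noteq> {}"
  then obtain xs where xs: "xs \<in> set ps" "xs \<in> set cs" by blast
  with c have "set xs \<noteq> {}" by (auto simp: config_def)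
  moreover have "(\<Union> (set ` set ps)) \<inter> (\<Union> (set ` set cs)) = {}"
    using c(1) by (simp add: config_def)
  then have "set xs \<inter> set xs = {}" using xs by fast
  ultimately show False by simp
qed

text \<open>Components are vertex disjoint, so a vertex on a path has all its edges on that
  path.\<close>

lemma config_edge_path:
  assumes "config n ps cs E" "p \<in> set ps" "v \<in> set p" "{v, w} \<in> E"
  shows "{v, w} \<in> pedges p"
proof -
  consider q where "q \<in> set ps" "{v, w} \<in> pedges q" | c where "c \<in> set cs" "{v, w} \<in> cedges c"
    using assms by (auto simp: config_def)
  then show ?thesis
  proof cases
    case (1 q)
    then have "v \<in> set q" using pedges_nsets[OF config_distinct, OF assms(1), of q]
      by (auto simp: nsets_def)
    with 1 show ?thesis using config_disjoint[OF assms(1), of p q v] assms by auto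
  next
    case (2 c)
    then have "v \<in> set c" using cedges_nsets[OF config_distinct, OF assms(1), of c] assms(1)
      by (auto simp: nsets_def config_def)
    with 2 show ?thesis
      using config_disjoint[OF assms(1), of p c v] config_Int[OF assms(1)] assms by auto
  qed
qed

lemma config_edge_cycle:
  assumes "config n ps cs E" "c \<in> set cs" "v \<in> set c" "{v, w} \<in> E"
  shows "{v, w} \<in> cedges c"
proof -
  consider q where "q \<in> set ps" "{v, w} \<in> pedges q" | d where "d \<in> set cs" "{v, w} \<in> cedges d"
    using assms by (auto simp: config_def)
  then show ?thesis
  proof cases
    case (1 q)
    then have "v \<in> set q" using pedges_nsets[OF config_distinct, OF assms(1), of q]
      by (auto simp: nsets_def)
    with 1 show ?thesis
      using config_disjoint[OF assms(1), of c q v] config_Int[OF assms(1)] assms by auto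
  next
    case (2 d)
    then have "v \<in> set d" using cedges_nsets[OF config_distinct, OF assms(1), of d] assms(1)
      by (auto simp: nsets_def config_def)
    with 2 show ?thesis using config_disjoint[OF assms(1), of c d v] assms by auto
  qed
qed

lemma config_path_nbrs:
  assumes "config n ps cs E" "xs @ v # ys \<in> set ps"
  shows "{v, w} \<in> E \<longleftrightarrow> xs \<noteq> [] \<and> w = last xs \<or> ys \<noteq> [] \<and> w = hd ys"
proof -
  have "{v, w} \<in> E \<longleftrightarrow> {v, w} \<in> pedges (xs @ v # ys)"
    using config_edge_path[OF assms] assms by (auto simp: config_def)
  moreover have "distinct (xs @ v # ys)" using config_distinct[OF assms(1), of "xs @ v # ys"] assms(2) by simp
  ultimately show ?thesis by (simp only: pedges_nbrs)
qed

text \<open>Rotation puts \<open>v\<close> first; its neighbours are then the two ends of the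
  remaining list, different because that list has at least two entries.\<close>

lemma config_cycle_nbrs:
  assumes "config n ps cs E" "c \<in> set cs" "v \<in> set c"
  obtains a b where "a \<noteq> b" "\<And>w. {v, w} \<in> E \<longleftrightarrow> w = a \<or> w = b"
proof -
  from assms(3) obtain xs ys where c: "c = xs @ v # ys" by (auto simp: in_set_conv_decomp)
  have d: "distinct (v # ys @ xs)" and l: "2 \<le> length (ys @ xs)"
    using config_distinct[OF assms(1), of c] assms(1,2) by (auto simp: c config_def)
  have "cedges c = cedges (v # ys @ xs)" using cedges_rotate[of xs "v # ys"] by (simp add: c)
  moreover have "{v, w} \<in> E \<longleftrightarrow> {v, w} \<in> cedges c" for w
    using config_edge_cycle[OF assms] assms by (auto simp: config_def)
  ultimately have "{v, w} \<in> E \<longleftrightarrow> w = hd (ys @ xs) \<or> w = last (ys @ xs)" for w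
    using cedges_nbrs[OF d l] by simp
  moreover have "hd (ys @ xs) \<noteq> last (ys @ xs)"
  proof -
    obtain y zs where "ys @ xs = y # zs" "zs \<noteq> []" using l by (cases "ys @ xs"; fastforce)
    with d show ?thesis by (metis distinct.simps(2) last_ConsR last_in_set list.sel(1))
  qed
  ultimately show ?thesis using that by blast
qed

lemma config_vertex:
  assumes "config n ps cs E" "v < n"
  obtains xs ys where "xs @ v # ys \<in> set ps" | c where "c \<in> set cs" "v \<in> set c"
proof -
  have "v \<in> set (concat (ps @ cs))" using assms by (auto simp: config_def)
  then obtain xs where "xs \<in> set ps \<or> xs \<in> set cs" "v \<in> set xs" by auto
  then show ?thesis using that by (metis in_set_conv_decomp)
qed

lemma config_free:
  assumes "config n ps cs E"
  shows "free S\<^sub>4 ({..<n}, E)"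
proof -
  have "\<not> distinct [a, b, c]" if e: "{v, a} \<in> E" "{v, b} \<in> E" "{v, c} \<in> E" for v a b c
  proof -
    have "v < n" using e config_nsets[OF assms] by (auto simp: nsets_def)
    from assms this show ?thesis
    proof (cases rule: config_vertex)
      case (1 xs ys)
      then show ?thesis using e config_path_nbrs[OF assms 1] by auto
    next
      case (2 c)
      from config_cycle_nbrs[OF assms this] e show ?thesis by (metis distinct_length_2_or_more)
    qed
  qed
  then show ?thesis unfolding free_S4[OF config_nsets[OF assms]] by blast
qed

section \<open>Legal moves: joining two paths and closing one\<close>

lemma config_moves:
  assumes "config n ps cs E" "config n ps' cs' (insert e E)" "e \<notin> E"
  shows "e \<in> moves S\<^sub>4 ({..<n}, E)"
  using config_nsets[OF assms(2)] config_free[OF assms(2)] assms(3)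
  by (auto simp: moves_def add_edge_def)

lemma config_join_new:
  assumes c: "config n (p # q # ps) cs E"
  shows "{last p, hd q} \<notin> E"
proof
  assume e: "{last p, hd q} \<in> E"
  have ne: "p \<noteq> []" "q \<noteq> []" using c by (auto simp: config_def)
  then have "{last p, hd q} \<in> pedges p" using config_edge_path[OF c _ _ e, of p] by simp
  then have "hd q \<in> set p" using pedges_nsets[OF config_distinct, OF c, of p] by (auto simp: nsets_def)
  with ne c show False by (cases q) (auto simp: config_def)
qed

lemma config_close_new:
  assumes c: "config n (p # ps) cs E" and l: "3 \<le> length p"
  shows "{hd p, last p} \<notin> E"
proof
  assume e: "{hd p, last p} \<in> E"
  obtain x y z zs where p: "p = x # y # z # zs"
    using l by (auto simp: numeral_eq_Suc Suc_le_length_iff)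
  have "last p = y" using e config_path_nbrs[OF c, of "[]" x "y # z # zs" "last p"] by (auto simp: p)
  moreover have "distinct p" using config_distinct[OF c, of p] by simp
  ultimately show False using last_in_set[of "z # zs"] by (simp add: p)
qed

text \<open>An inner vertex of a path already has two neighbours, so a further edge there would
  create an S_4.\<close>

lemma config_end:
  assumes c: "config n ps cs E" and e: "{v, w} \<in> moves S\<^sub>4 ({..<n}, E)"
    and p: "p \<in> set ps" "v \<in> set p"
  shows "v = hd p \<or> v = last p"
proof -
  from p(2) obtain xs ys where xy: "p = xs @ v # ys" by (auto simp: in_set_conv_decomp)
  have "xs = [] \<or> ys = []"
  proof (rule ccontr)
    assume "\<not> ?thesis"
    then have "last xs \<noteq> hd ys" "{v, last xs} \<in> E" "{v, hd ys} \<in> E"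
      using config_distinct[OF c, of p] p config_path_nbrs[OF c, of xs v ys]
      by (auto simp: xy disjoint_iff) (metis hd_in_set last_in_set)
    moreover have "free S\<^sub>4 ({..<n}, insert {v, w} E)" "insert {v, w} E \<subseteq> [{..<n}]\<^bsup>2\<^esup>" "{v, w} \<notin> E"
      using e config_nsets[OF c] by (auto simp: moves_def add_edge_def)
    ultimately show False
      unfolding free_S4[OF \<open>insert {v, w} E \<subseteq> [{..<n}]\<^bsup>2\<^esup>\<close>]
      by (metis distinct_length_2_or_more distinct_singleton insertCI)
  qed
  then show ?thesis by (auto simp: xy)
qed

lemma config_move_vertex:
  assumes c: "config n ps cs E" and e: "{v, w} \<in> moves S\<^sub>4 ({..<n}, E)"
  obtains p where "p \<in> set ps" "v \<in> set p"
proof -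
  have *: "free S\<^sub>4 ({..<n}, insert {v, w} E)" "insert {v, w} E \<subseteq> [{..<n}]\<^bsup>2\<^esup>" "{v, w} \<notin> E"
    using e config_nsets[OF c] by (auto simp: moves_def add_edge_def)
  then have "v < n" by (auto simp: nsets_def)
  with c show ?thesis
  proof (cases rule: config_vertex)
    case (2 d)
    from config_cycle_nbrs[OF c this] obtain a b where "a \<noteq> b" "{v, a} \<in> E" "{v, b} \<in> E" by metis
    with * show ?thesis
      unfolding free_S4[OF *(2)]
      by (metis distinct_length_2_or_more distinct_singleton insertCI)
  qed (use that in auto)
qed

lemma config_last:
  assumes c: "config n (p # ps) cs E" and "v = hd p \<or> v = last p"
  obtains p' where "config n (p' # ps) cs E" "last p' = v" "length p' = length p" "set p' = set p"
proof (cases "v = last p")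
  case False
  then have "last (rev p) = v" using assms by (auto simp: config_def last_rev)
  with config_rev[OF c] that[of "rev p"] show ?thesis by simp
qed (use that c in auto)

text \<open>By degrees, a new edge connects path ends: ends of one path close it to a cycle, ends of
  different paths join them. The primed lists are the chosen paths run through in a suitable
  direction.\<close>

lemma config_move_cases:
  assumes c: "config n ps cs E" and e: "e \<in> moves S\<^sub>4 ({..<n}, E)"
  obtains (join) p q p' q' ps' where "mset ps = mset (p # q # ps')"
      "config n ((p' @ q') # ps') cs (insert e E)" "length p' = length p" "length q' = length q"
  | (close) p p' ps' where "mset ps = mset (p # ps')" "3 \<le> length p"
      "config n ps' (p' # cs) (insert e E)" "length p' = length p"
proof -
  have "e \<in> [{..<n}]\<^bsup>2\<^esup>" using e by (simp add: moves_def)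
  then obtain u v where uv: "e = {u, v}" "u \<noteq> v" by (auto simp: nsets_def card_2_iff)
  note eu = e[unfolded uv] and ev = e[unfolded uv insert_commute[of u]]
  obtain p where p: "p \<in> set ps" "u \<in> set p" by (rule config_move_vertex[OF c eu])
  then obtain ps1 where ps1: "mset ps = mset (p # ps1)"
    by (metis insert_DiffM mset.simps(2) mset_remove1 set_mset_mset)
  have c1: "config n (p # ps1) cs E" using c config_perm[OF ps1] by simp
  obtain p' where c2: "config n (p' # ps1) cs E" and p': "last p' = u" "length p' = length p" "set p' = set p"
    by (rule config_last[OF c1 config_end[OF c eu p]])
  obtain q where q: "q \<in> set (p' # ps1)" "v \<in> set q" by (rule config_move_vertex[OF c2 ev])
  then consider "v \<in> set p'" | "q \<in> set ps1" by auto
  then show ?thesis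
  proof cases
    case 1
    then have hd: "v = hd p'" using config_end[OF c2 ev, of p'] uv p' by auto
    \<comment> \<open>On two vertices the closing edge would be the edge of the path, which is
      already claimed.\<close>
    have "3 \<le> length p'"
    proof (rule ccontr)
      assume "\<not> ?thesis"
      then have "p' = [v, u]" using hd p' uv 1 by (cases p'; cases "tl p'"; cases "tl (tl p')") auto
      with c2 have "{v, u} \<in> E" by (auto simp: config_def)
      with e show False by (auto simp: moves_def uv insert_commute)
    qed
    with config_close[OF c2] hd p' ps1 show ?thesis
      by (intro close[of p ps1 p']) (simp_all add: uv insert_commute)
  next
    case 2
    then obtain ps2 where ps2: "mset ps1 = mset (q # ps2)"
      by (metis insert_DiffM mset.simps(2) mset_remove1 set_mset_mset)
    have c3: "config n (q # p' # ps2) cs E"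
      using c2 config_perm[of "p' # ps1" "q # p' # ps2"] ps2 by simp
    obtain q' where c4: "config n (q' # p' # ps2) cs E" and q': "last q' = v" "length q' = length q" "set q' = set q"
      by (rule config_last[OF c3 config_end[OF c3 ev]]) (use q in auto)
    \<comment> \<open>\<open>q'\<close> ends in \<open>v\<close>, while \<open>config_join\<close>
      needs \<open>v\<close> at the front.\<close>
    have c5: "config n (rev q' # p' # ps2) cs E" by (rule config_rev[OF c4])
    have c6: "config n (p' # rev q' # ps2) cs E"
      using c5 config_perm[of "rev q' # p' # ps2" "p' # rev q' # ps2"] by simp
    have "hd (rev q') = v" using q' by (simp add: hd_rev)
    with config_join[OF c6] p' q' ps1 ps2 show ?thesis
      by (intro join[of p q ps2 p' "rev q'"]) (simp_all add: uv)
  qed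
qed

section \<open>The score of a final position\<close>

text \<open>A P_4 is connected and hence lies in one component; a path on at most two vertices is
  too small for it.\<close>

lemma P4s_config:
  assumes c: "config n ps cs E" and short: "\<And>p. p \<in> set ps \<Longrightarrow> length p \<le> 2"
  shows "P4s E = (\<Union>c\<in>set cs. P4s (cedges c))"
proof (intro equalityI subsetI)
  fix K assume "K \<in> P4s E"
  then obtain x y z w where K: "K = ({x, y, z, w}, {{x, y}, {y, z}, {z, w}})"
    and xyzw: "distinct [x, y, z, w]" "{x, y} \<in> E" "{y, z} \<in> E" "{z, w} \<in> E"
    by (rule P4sE)
  have "x < n" using xyzw(2) config_nsets[OF c] by (auto simp: nsets_def)
  with c show "K \<in> (\<Union>c\<in>set cs. P4s (cedges c))"
  proof (cases rule: config_vertex)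
    case (1 xs ys)
    let ?p = "xs @ x # ys"
    note in_p = subsetD[OF pedges_nsets[OF config_distinct[OF c, of ?p]]]
    have y: "y \<in> set ?p" using in_p[OF _ config_edge_path[OF c 1 _ xyzw(2)]] 1
      by (auto simp: nsets_def)
    then have "z \<in> set ?p" using in_p[OF _ config_edge_path[OF c 1 _ xyzw(3)]] 1
      by (auto simp: nsets_def)
    with y have "card {x, y, z} \<le> length ?p"
      by (intro order.trans[OF card_mono card_length]) auto
    with short[OF 1] xyzw(1) show ?thesis by simp
  next
    case (2 d)
    then have "3 \<le> length d" using c by (simp add: config_def)
    then have in_d: "e \<in> [set d]\<^bsup>2\<^esup>" if "e \<in> cedges d" for e
      using cedges_nsets[OF config_distinct[OF c]] 2 that by auto
    note e = config_edge_cycle[OF c 2(1)]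
    have xy: "{x, y} \<in> cedges d" using e 2 xyzw by simp
    then have "y \<in> set d" using in_d[of "{x, y}"] by (simp add: nsets_def)
    then have yz: "{y, z} \<in> cedges d" using e xyzw by simp
    then have "z \<in> set d" using in_d[of "{y, z}"] by (simp add: nsets_def)
    then have zw: "{z, w} \<in> cedges d" using e xyzw by simp
    from P4sI[OF xyzw(1) xy yz zw] 2(1) show ?thesis unfolding K by blast
  qed
next
  fix K assume "K \<in> (\<Union>c\<in>set cs. P4s (cedges c))"
  then obtain d where d: "d \<in> set cs" "K \<in> P4s (cedges d)" by blast
  have "cedges d \<subseteq> E" using c d(1) by (auto simp: config_def)
  with d(2) show "K \<in> P4s E" by (elim P4sE) (simp only: P4sI subsetD)
qed

text \<open>Serves twice: a triangle has too few vertices for a copy, and copies in different cycles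
  have disjoint vertex sets and so differ.\<close>

lemma verts_P4s_cedges:
  assumes "distinct c" "3 \<le> length c" "K \<in> P4s (cedges c)"
  shows "verts K \<subseteq> set c" "card (verts K) = 4"
proof -
  obtain x y z w where K: "K = ({x, y, z, w}, {{x, y}, {y, z}, {z, w}})"
    and xyzw: "distinct [x, y, z, w]" "{x, y} \<in> cedges c" "{y, z} \<in> cedges c" "{z, w} \<in> cedges c"
    using assms(3) by (rule P4sE)
  show "verts K \<subseteq> set c"
    using subsetD[OF cedges_nsets[OF assms(1,2)] xyzw(2)]
      subsetD[OF cedges_nsets[OF assms(1,2)] xyzw(4)] by (simp add: K nsets_def)
  show "card (verts K) = 4" using xyzw(1) by (simp add: K)
qed

text \<open>Paths with four or more vertices all count as size \<open>4\<close>.\<close>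
definition num :: "nat \<Rightarrow> 'a list list \<Rightarrow> nat" where
  "num k xss = length (filter (\<lambda>xs. min 4 (length xs) = k) xss)"

lemma num_Nil [simp]: "num k [] = 0"
  by (simp add: num_def)

lemma num_Cons [simp]: "num k (xs # xss) = (if min 4 (length xs) = k then 1 else 0) + num k xss"
  by (simp add: num_def)

lemma num_perm: "mset xss = mset yss \<Longrightarrow> num k xss = num k yss"
  unfolding num_def by (metis mset_filter size_mset)

lemma num_pick:
  assumes "0 < num k xss"
  obtains xs yss where "mset xss = mset (xs # yss)" "min 4 (length xs) = k"
proof -
  from assms obtain xs where xs: "xs \<in> set xss" "min 4 (length xs) = k"
    by (auto simp: num_def filter_empty_conv)
  then have "mset xss = mset (xs # remove1 xs xss)" by simp
  with xs that show ?thesis by blast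
qed

text \<open>A cycle of length m \<ge> 4 contributes m and a triangle 0, so the score is the number
  of vertices on long cycles. The other vertices lie on triangles or on paths with one or two
  vertices.\<close>

lemma score_config:
  assumes c: "config n ps cs E" and "num 3 ps = 0" "num 4 ps = 0"
  shows "score P\<^sub>4 ({..<n}, E) + 3 * num 3 cs + num 1 ps + 2 * num 2 ps = n"
proof -
  have short: "length p = 1 \<or> length p = 2" if "p \<in> set ps" for p
  proof -
    have "min 4 (length p) \<noteq> 3" "min 4 (length p) \<noteq> 4" "length p \<noteq> 0"
      using assms that by (auto simp: num_def filter_empty_conv config_def)
    then show ?thesis by linarith
  qed
  have cyc: "distinct d" "3 \<le> length d" if "d \<in> set cs" for d
    using config_distinct[OF c] c that by (auto simp: config_def)
  have card: "card (P4s (cedges d)) = (if 4 \<le> length d then length d else 0)"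
    and fin: "finite (P4s (cedges d))" if "d \<in> set cs" for d
  proof -
    have "P4s (cedges d) = {}" if "length d < 4"
    proof (rule ccontr)
      assume "P4s (cedges d) \<noteq> {}"
      then obtain K where "K \<in> P4s (cedges d)" by blast
      note K = verts_P4s_cedges[OF cyc[OF \<open>d \<in> set cs\<close>] this]
      then have "4 \<le> card (set d)" by (metis List.finite_set card_mono)
      with card_length[of d] that show False by simp
    qed
    then show "card (P4s (cedges d)) = (if 4 \<le> length d then length d else 0)"
      using card_P4s_cedges[OF cyc(1)[OF that]] by simp
    then show "finite (P4s (cedges d))"
      using \<open>length d < 4 \<Longrightarrow> P4s (cedges d) = {}\<close>
      by (metis card.infinite finite.emptyI not_le not_numeral_le_zero)
  qed
  have disj: "P4s (cedges d) \<inter> P4s (cedges d') = {}"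
    if "d \<in> set cs" "d' \<in> set cs" "d \<noteq> d'" for d d'
  proof (rule ccontr)
    assume "P4s (cedges d) \<inter> P4s (cedges d') \<noteq> {}"
    then obtain K where K: "K \<in> P4s (cedges d)" "K \<in> P4s (cedges d')" by blast
    note v = verts_P4s_cedges[OF cyc[OF that(1)] K(1)] verts_P4s_cedges(1)[OF cyc[OF that(2)] K(2)]
    then obtain x where "x \<in> verts K" by fastforce
    then show False using config_disjoint[OF c, of d d' x] v that by auto
  qed
  \<comment> \<open>Distinctness of the concatenation separates only nonempty lists. Distinctness of
    \<open>cs\<close> is what turns the sum over the set of cycles into one over the list.\<close>
  have "[] \<notin> set cs" using cyc(2) by force
  moreover have "distinct (removeAll [] cs)" using c by (simp add: config_def distinct_concat_iff)
  ultimately have "distinct cs" by simp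
  have "score P\<^sub>4 ({..<n}, E) = card (\<Union>d\<in>set cs. P4s (cedges d))"
    unfolding score_def copies_P4[OF config_nsets[OF c]]
    by (subst P4s_config[OF c]) (auto dest: short)
  also have "\<dots> = (\<Sum>d\<in>set cs. card (P4s (cedges d)))"
    using fin disj by (intro card_UN_disjoint) auto
  also have "\<dots> = (\<Sum>d\<in>set cs. if 4 \<le> length d then length d else 0)"
    using card by (rule sum.cong[OF refl])
  also have "\<dots> = sum_list (map (\<lambda>d. if 4 \<le> length d then length d else 0) cs)"
    using \<open>distinct cs\<close> by (rule sum_list_distinct_conv_sum_set[symmetric])
  also have "\<dots> + 3 * num 3 cs = sum_list (map length cs)"
    using cyc(2)
  proof (induction cs)
    case (Cons d cs)
    then have "length d = 3 \<or> 4 \<le> length d" by force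
    with Cons show ?case by auto
  qed simp
  finally have *: "score P\<^sub>4 ({..<n}, E) + 3 * num 3 cs = sum_list (map length cs)" by simp
  have "num 1 ps + 2 * num 2 ps = sum_list (map length ps)"
    using short
  proof (induction ps)
    case (Cons p ps)
    then have "length p = 1 \<or> length p = 2" "num 1 ps + 2 * num 2 ps = sum_list (map length ps)"
      by simp_all
    then show ?case by auto
  qed simp
  moreover have "n = length (concat (ps @ cs))"
    using c distinct_card[of "concat (ps @ cs)"] by (simp add: config_def)
  ultimately show ?thesis using * by (simp add: length_concat)
qed

subsection \<open>The game on tuples\<close>

text \<open>Joining two paths with at least four vertices has the same effect on the tuple as closing one
  of them, so it has no rule of its own.\<close>
inductive step :: "nat \<times> nat \<times> nat \<times> nat \<times> nat \<Rightarrow> nat \<times> nat \<times> nat \<times> nat \<times> nat \<Rightarrow> bool" where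
  "step (Suc (Suc i), e, p, q, t) (i, Suc e, p, q, t)"
| "step (Suc i, Suc e, p, q, t) (i, e, Suc p, q, t)"
| "step (Suc i, e, Suc p, q, t) (i, e, p, Suc q, t)"
| "step (Suc i, e, p, Suc q, t) (i, e, p, Suc q, t)"
| "step (i, Suc (Suc e), p, q, t) (i, e, p, Suc q, t)"
| "step (i, Suc e, Suc p, q, t) (i, e, p, Suc q, t)"
| "step (i, Suc e, p, Suc q, t) (i, e, p, Suc q, t)"
| "step (i, e, Suc (Suc p), q, t) (i, e, p, Suc q, t)"
| "step (i, e, Suc p, Suc q, t) (i, e, p, Suc q, t)"
| "step (i, e, Suc p, q, t) (i, e, p, q, Suc t)"
| "step (i, e, p, Suc q, t) (i, e, p, q, t)"

section \<open>Correspondence between positions and tuples\<close>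

text \<open>Long cycles leave no trace in the tuple, as their vertices cost nothing.\<close>

definition rep :: "nat \<Rightarrow> nat set set \<Rightarrow> nat \<times> nat \<times> nat \<times> nat \<times> nat \<Rightarrow> bool" where
  "rep n E s \<longleftrightarrow> (\<exists>ps cs. config n ps cs E \<and>
     s = (num 1 ps, num 2 ps, num 3 ps, num 4 ps, num 3 cs))"

lemma rep_empty: "rep n {} (n, 0, 0, 0, 0)"
proof -
  have "num k (map (\<lambda>v. [v]) xs) = (if k = 1 then length xs else 0)" for k and xs :: "nat list"
    by (induction xs) auto
  then show ?thesis unfolding rep_def using config_empty[of n] by fastforce
qed

lemma min4_cases:
  assumes "xs \<noteq> []"
  obtains "length xs = 1" | "length xs = 2" | "length xs = 3" | "4 \<le> length xs"
proof -
  have "length xs \<noteq> 0" using assms by simp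
  then show ?thesis using that by linarith
qed

text \<open>Together with \<open>rep_step\<close> this makes \<open>rep\<close> a bisimulation
  between the graph game and the game on tuples.\<close>

lemma rep_move:
  assumes "rep n E s" "m \<in> moves S\<^sub>4 ({..<n}, E)"
  obtains s' where "step s s'" "rep n (insert m E) s'"
proof -
  obtain ps cs where c: "config n ps cs E"
    and s: "s = (num 1 ps, num 2 ps, num 3 ps, num 4 ps, num 3 cs)"
    using assms(1) by (auto simp: rep_def)
  from c assms(2) show ?thesis
  proof (cases rule: config_move_cases)
    case (join p q p' q' ps')
    have "config n (p # q # ps') cs E" using c config_perm[OF join(1)] by simp
    then have ne: "p \<noteq> []" "q \<noteq> []" by (auto simp: config_def)
    let ?N = "\<lambda>xss. (num 1 xss, num 2 xss, num 3 xss, num 4 xss, num 3 cs)"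
    have "rep n (insert m E) (?N ((p' @ q') # ps'))"
      using join(2) unfolding rep_def by blast
    moreover have "step (?N (p # q # ps')) (?N ((p' @ q') # ps'))"
      using ne(1)
    proof (cases rule: min4_cases)
      case 1
      from ne(2) show ?thesis
        by (cases rule: min4_cases) (simp_all add: 1 join(3,4) step.intros)
    next
      case 2
      from ne(2) show ?thesis
        by (cases rule: min4_cases) (simp_all add: 2 join(3,4) step.intros)
    next
      case 3
      from ne(2) show ?thesis
        by (cases rule: min4_cases) (simp_all add: 3 join(3,4) step.intros)
    next
      case 4
      from ne(2) show ?thesis
        by (cases rule: min4_cases) (use 4 in \<open>simp_all add: join(3,4) step.intros\<close>)
    qed
    ultimately show ?thesis using that s num_perm[OF join(1)] by simp
  next
    case (close p p' ps')
    let ?N = "\<lambda>xss yss. (num 1 xss, num 2 xss, num 3 xss, num 4 xss, num 3 yss)"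
    have "rep n (insert m E) (?N ps' (p' # cs))" using close(3) unfolding rep_def by blast
    moreover have "step (?N (p # ps') cs) (?N ps' (p' # cs))"
      using close(2,4) by (cases "length p = 3") (simp_all add: step.intros)
    ultimately show ?thesis using that s num_perm[OF close(1)] by simp
  qed
qed

text \<open>For \<open>a = b\<close> a second path of that size is required. The counts are balanced
  by additions on both sides, which stays correct when the joined size coincides with
  \<open>a\<close> or \<open>b\<close>.\<close>

lemma config_join_exists:
  assumes c: "config n ps cs E" and a: "0 < num a ps" and b: "(if a = b then 1 else 0) < num b ps"
  obtains m ps' where "m \<in> moves S\<^sub>4 ({..<n}, E)" "config n ps' cs (insert m E)"
    "\<And>k. num k ps + (if k = min 4 (a + b) then 1 else 0)
      = num k ps' + (if k = a then 1 else 0) + (if k = b then 1 else 0)"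
proof -
  obtain p ps1 where p: "mset ps = mset (p # ps1)" "min 4 (length p) = a" by (rule num_pick[OF a])
  have "0 < num b ps1" using b num_perm[OF p(1), of b] p(2) by (auto split: if_splits)
  then obtain q ps2 where q: "mset ps1 = mset (q # ps2)" "min 4 (length q) = b" by (rule num_pick)
  have ps: "mset ps = mset (p # q # ps2)" using p q by simp
  then have c1: "config n (p # q # ps2) cs E" using c config_perm by blast
  note c2 = config_join[OF c1]
  have "min 4 (length (p @ q)) = min 4 (a + b)" using p q by auto
  then show ?thesis
    using num_perm[OF ps] p(2) q(2)
    by (intro that[OF config_moves[OF c1 c2 config_join_new[OF c1]] c2]) auto
qed

lemma config_close_exists:
  assumes c: "config n ps cs E" and a: "0 < num a ps" "3 \<le> a"
  obtains m ps' c where "m \<in> moves S\<^sub>4 ({..<n}, E)" "config n ps' (c # cs) (insert m E)"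
    "min 4 (length c) = a" "\<And>k. num k ps = num k ps' + (if k = a then 1 else 0)"
proof -
  obtain p ps1 where p: "mset ps = mset (p # ps1)" "min 4 (length p) = a" by (rule num_pick[OF a(1)])
  then have c1: "config n (p # ps1) cs E" using c config_perm by blast
  have l: "3 \<le> length p" using p(2) a(2) by auto
  note c2 = config_close[OF c1 l]
  show ?thesis
    using num_perm[OF p(1)] p(2)
    by (intro that[OF config_moves[OF c1 c2 config_close_new[OF c1 l]] c2]) auto
qed

lemma rep_step:
  assumes "rep n E s" "step s s'"
  obtains m where "m \<in> moves S\<^sub>4 ({..<n}, E)" "rep n (insert m E) s'"
proof -
  obtain ps cs where c: "config n ps cs E"
    and s: "s = (num 1 ps, num 2 ps, num 3 ps, num 4 ps, num 3 cs)"
    using assms(1) by (auto simp: rep_def)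
  note found = that
  \<comment> \<open>Every rule joins or closes. The balance of the counts pins down the new tuple,
    so each of the eleven rules becomes an instance of one of these two facts.\<close>
  have join: thesis if ab: "0 < num a ps" "(if a = b then 1 else 0) < num b ps"
    and s': "\<And>ps' :: nat list list. \<forall>k\<in>{1, 2, 3, 4}. num k ps + (if k = min 4 (a + b) then 1 else 0)
      = num k ps' + (if k = a then 1 else 0) + (if k = b then 1 else 0)
      \<Longrightarrow> s' = (num 1 ps', num 2 ps', num 3 ps', num 4 ps', num 3 cs)" for a b
  proof -
    obtain m ps' where m: "m \<in> moves S\<^sub>4 ({..<n}, E)" "config n ps' cs (insert m E)"
      and eq: "\<And>k. num k ps + (if k = min 4 (a + b) then 1 else 0)
        = num k ps' + (if k = a then 1 else 0) + (if k = b then 1 else 0)"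
      using config_join_exists[OF c ab] by blast
    have "s' = (num 1 ps', num 2 ps', num 3 ps', num 4 ps', num 3 cs)"
      by (intro s' ballI eq)
    with m(2) have "rep n (insert m E) s'" unfolding rep_def by blast
    with m(1) show thesis by (rule found)
  qed
  have close: thesis if a: "0 < num a ps" "3 \<le> a"
    and s': "\<And>(ps' :: nat list list) (d :: nat list). min 4 (length d) = a \<Longrightarrow>
      \<forall>k\<in>{1, 2, 3, 4}. num k ps = num k ps' + (if k = a then 1 else 0)
      \<Longrightarrow> s' = (num 1 ps', num 2 ps', num 3 ps', num 4 ps', num 3 (d # cs))" for a
  proof -
    obtain m ps' d where m: "m \<in> moves S\<^sub>4 ({..<n}, E)" "config n ps' (d # cs) (insert m E)"
      and d: "min 4 (length d) = a" and eq: "\<And>k. num k ps = num k ps' + (if k = a then 1 else 0)"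
      using config_close_exists[OF c a] by blast
    have "s' = (num 1 ps', num 2 ps', num 3 ps', num 4 ps', num 3 (d # cs))"
      by (intro s' ballI eq d)
    with m(2) have "rep n (insert m E) s'" unfolding rep_def by blast
    with m(1) show thesis by (rule found)
  qed
  from assms(2) show thesis
  proof cases
    case (1 i e p q t)
    with s show ?thesis by (intro join[of 1 1]) auto
  next
    case (2 i e p q t)
    with s show ?thesis by (intro join[of 1 2]) auto
  next
    case (3 i e p q t)
    with s show ?thesis by (intro join[of 1 3]) auto
  next
    case (4 i e p q t)
    with s show ?thesis by (intro join[of 1 4]) auto
  next
    case (5 i e p q t)
    with s show ?thesis by (intro join[of 2 2]) auto
  next
    case (6 i e p q t)
    with s show ?thesis by (intro join[of 2 3]) auto
  next
    case (7 i e p q t)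
    with s show ?thesis by (intro join[of 2 4]) auto
  next
    case (8 i e p q t)
    with s show ?thesis by (intro join[of 3 3]) auto
  next
    case (9 i e p q t)
    with s show ?thesis by (intro join[of 3 4]) auto
  next
    case (10 i e p q t)
    with s show ?thesis by (intro close[of 3]) auto
  next
    case (11 i e p q t)
    with s show ?thesis by (intro close[of 4]) auto
  qed
qed

lemma step_iff:
  "step (i, e, p, q, t) s \<longleftrightarrow>
     2 \<le> i \<and> s = (i - 2, e + 1, p, q, t) \<or>
     1 \<le> i \<and> 1 \<le> e \<and> s = (i - 1, e - 1, p + 1, q, t) \<or>
     1 \<le> i \<and> 1 \<le> p \<and> s = (i - 1, e, p - 1, q + 1, t) \<or>
     1 \<le> i \<and> 1 \<le> q \<and> s = (i - 1, e, p, q, t) \<or>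
     2 \<le> e \<and> s = (i, e - 2, p, q + 1, t) \<or>
     1 \<le> e \<and> 1 \<le> p \<and> s = (i, e - 1, p - 1, q + 1, t) \<or>
     1 \<le> e \<and> 1 \<le> q \<and> s = (i, e - 1, p, q, t) \<or>
     2 \<le> p \<and> s = (i, e, p - 2, q + 1, t) \<or>
     1 \<le> p \<and> 1 \<le> q \<and> s = (i, e, p - 1, q, t) \<or>
     1 \<le> p \<and> s = (i, e, p - 1, q, t + 1) \<or>
     1 \<le> q \<and> s = (i, e, p, q - 1, t)" (is "_ \<longleftrightarrow> ?R")
proof
  assume "step (i, e, p, q, t) s"
  then show ?R by cases simp_all
next
  show "?R \<Longrightarrow> step (i, e, p, q, t) s"
    by (elim disjE conjE) (auto dest!: le_Suc_ex intro: step.intros)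
qed

lemma ex_step:
  "(\<exists>s'. step (i, e, p, q, t) s' \<and> P s') \<longleftrightarrow>
     2 \<le> i \<and> P (i - 2, e + 1, p, q, t) \<or>
     1 \<le> i \<and> 1 \<le> e \<and> P (i - 1, e - 1, p + 1, q, t) \<or>
     1 \<le> i \<and> 1 \<le> p \<and> P (i - 1, e, p - 1, q + 1, t) \<or>
     1 \<le> i \<and> 1 \<le> q \<and> P (i - 1, e, p, q, t) \<or>
     2 \<le> e \<and> P (i, e - 2, p, q + 1, t) \<or>
     1 \<le> e \<and> 1 \<le> p \<and> P (i, e - 1, p - 1, q + 1, t) \<or>
     1 \<le> e \<and> 1 \<le> q \<and> P (i, e - 1, p, q, t) \<or>
     2 \<le> p \<and> P (i, e, p - 2, q + 1, t) \<or>
     1 \<le> p \<and> 1 \<le> q \<and> P (i, e, p - 1, q, t) \<or>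
     1 \<le> p \<and> P (i, e, p - 1, q, t + 1) \<or>
     1 \<le> q \<and> P (i, e, p, q - 1, t)"
  unfolding step_iff
  by (simp only: conj_disj_distribR ex_disj_distrib conj_assoc simp_thms ex_simps)

lemma stuck_iff: "(\<nexists>s'. step (i, e, p, q, t) s') \<longleftrightarrow> i + e \<le> 1 \<and> p = 0 \<and> q = 0"
proof
  assume "\<nexists>s'. step (i, e, p, q, t) s'"
  then have "\<not> 2 \<le> i" "\<not> (1 \<le> i \<and> 1 \<le> e)" "\<not> 2 \<le> e" "\<not> 1 \<le> p" "\<not> 1 \<le> q"
    using ex_step[of i e p q t "\<lambda>_. True"] by (simp_all only: simp_thms de_Morgan_disj)
  then show "i + e \<le> 1 \<and> p = 0 \<and> q = 0" by linarith
qed (auto simp: step_iff)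

text \<open>Only used at stuck tuples, where \<open>p\<close> and \<open>q\<close> vanish.\<close>
fun cost :: "nat \<times> nat \<times> nat \<times> nat \<times> nat \<Rightarrow> nat" where
  "cost (i, e, p, q, t) = i + 2 * e + 3 * t"

lemma saturated_rep:
  assumes "rep n E s"
  shows "saturated S\<^sub>4 ({..<n}, E) \<longleftrightarrow> (\<nexists>s'. step s s')"
proof -
  have "free S\<^sub>4 ({..<n}, E)" using assms by (auto simp: rep_def intro: config_free)
  then have "saturated S\<^sub>4 ({..<n}, E) \<longleftrightarrow> moves S\<^sub>4 ({..<n}, E) = {}"
    by (auto simp: saturated_def moves_def)
  also have "\<dots> \<longleftrightarrow> (\<nexists>s'. step s s')"
    using rep_move[OF assms] rep_step[OF assms] by (metis all_not_in_conv)
  finally show ?thesis .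
qed

lemma score_rep:
  assumes r: "rep n E s" and "\<nexists>s'. step s s'"
  shows "score P\<^sub>4 ({..<n}, E) + cost s = n"
proof -
  obtain ps cs where c: "config n ps cs E"
    and s: "s = (num 1 ps, num 2 ps, num 3 ps, num 4 ps, num 3 cs)"
    using r by (auto simp: rep_def)
  have "num 3 ps = 0" "num 4 ps = 0" using assms(2) unfolding s stuck_iff by simp_all
  with score_config[OF c] show ?thesis by (simp add: s)
qed

section \<open>From strategies to bounds on the game value\<close>

lemma finite_moves: "finite (moves F ({..<n :: nat}, E))"
  by (rule finite_subset[OF _ finite_imp_finite_nsets[of "{..<n}" 2]]) (auto simp: moves_def)

text \<open>\<open>I\<close> encodes a strategy of Max as the set of positions it allows, and
  \<open>c\<close> is the loss it guarantees. The step to \<open>s'\<close> in the premise for Max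
  only says that the game is not over. The induction is on the number of unclaimed edges.\<close>

lemma game_value_ge:
  assumes Mini: "\<And>s s'. I Mini s \<Longrightarrow> step s s' \<Longrightarrow> I Maxi s'"
    and Maxi: "\<And>s s'. I Maxi s \<Longrightarrow> step s s' \<Longrightarrow> \<exists>s''. step s s'' \<and> I Mini s''"
    and stop: "\<And>x s. I x s \<Longrightarrow> (\<nexists>s'. step s s') \<Longrightarrow> cost s \<le> c"
    and "rep n E s" "I x s"
  shows "n \<le> game_value S\<^sub>4 P\<^sub>4 n x E + c"
  using assms(4,5)
proof (induction "card ([{..<n}]\<^bsup>2\<^esup> - E)" arbitrary: x E s rule: less_induct)
  case less
  show ?case
  proof (cases "\<exists>s'. step s s'")
    case False
    then have "game_value S\<^sub>4 P\<^sub>4 n x E = score P\<^sub>4 ({..<n}, E)"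
      using saturated_rep[OF less.prems(1)] by (subst game_value.simps) simp
    with stop[OF less.prems(2) False] score_rep[OF less.prems(1) False] show ?thesis by simp
  next
    case True
    then have ns: "\<not> saturated S\<^sub>4 ({..<n}, E)" using saturated_rep[OF less.prems(1)] by simp
    let ?M = "moves S\<^sub>4 ({..<n}, E)"
    show ?thesis
    proof (cases x)
      case Maxi
      let ?g = "\<lambda>m. game_value S\<^sub>4 P\<^sub>4 n Mini (insert m E)"
      obtain s' where s': "step s s'" "I Mini s'" using assms(2) less.prems(2) True Maxi by blast
      obtain m where m: "m \<in> ?M" "rep n (insert m E) s'"
        by (rule rep_step[OF less.prems(1) s'(1)])
      have "n \<le> ?g m + c" using less.hyps[OF remaining_edges_decrease[OF m(1)] m(2) s'(2)] .
      also have "?g m \<le> Max (?g ` ?M)" by (intro Max_ge finite_imageI finite_moves imageI m(1))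
      also have "\<dots> = game_value S\<^sub>4 P\<^sub>4 n x E" using ns Maxi by (subst (2) game_value.simps) simp
      finally show ?thesis by simp
    next
      case Mini
      let ?g = "\<lambda>m. game_value S\<^sub>4 P\<^sub>4 n Maxi (insert m E)"
      have "?M \<noteq> {}" using rep_step[OF less.prems(1)] True by blast
      then have "Min (?g ` ?M) \<in> ?g ` ?M" by (intro Min_in finite_imageI finite_moves) simp
      then obtain m where m: "m \<in> ?M" "Min (?g ` ?M) = ?g m" by blast
      obtain s' where s': "step s s'" "rep n (insert m E) s'"
        by (rule rep_move[OF less.prems(1) m(1)])
      have "I Maxi s'" using assms(1) less.prems(2) Mini s'(1) by blast
      from less.hyps[OF remaining_edges_decrease[OF m(1)] s'(2) this]
      have "n \<le> ?g m + c" .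
      also have "?g m = game_value S\<^sub>4 P\<^sub>4 n x E"
        using ns Mini m(2) by (subst (2) game_value.simps) simp
      finally show ?thesis by simp
    qed
  qed
qed

text \<open>The mirror image, with \<open>I\<close> a strategy of Mini and \<open>c\<close> a loss
  that she enforces.\<close>

lemma game_value_le:
  assumes Maxi: "\<And>s s'. I Maxi s \<Longrightarrow> step s s' \<Longrightarrow> I Mini s'"
    and Mini: "\<And>s s'. I Mini s \<Longrightarrow> step s s' \<Longrightarrow> \<exists>s''. step s s'' \<and> I Maxi s''"
    and stop: "\<And>x s. I x s \<Longrightarrow> (\<nexists>s'. step s s') \<Longrightarrow> c \<le> cost s"
    and "rep n E s" "I x s"
  shows "game_value S\<^sub>4 P\<^sub>4 n x E + c \<le> n"
  using assms(4,5)
proof (induction "card ([{..<n}]\<^bsup>2\<^esup> - E)" arbitrary: x E s rule: less_induct)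
  case less
  show ?case
  proof (cases "\<exists>s'. step s s'")
    case False
    then have "game_value S\<^sub>4 P\<^sub>4 n x E = score P\<^sub>4 ({..<n}, E)"
      using saturated_rep[OF less.prems(1)] by (subst game_value.simps) simp
    with stop[OF less.prems(2) False] score_rep[OF less.prems(1) False] show ?thesis by simp
  next
    case True
    then have ns: "\<not> saturated S\<^sub>4 ({..<n}, E)" using saturated_rep[OF less.prems(1)] by simp
    let ?M = "moves S\<^sub>4 ({..<n}, E)"
    show ?thesis
    proof (cases x)
      case Mini
      let ?g = "\<lambda>m. game_value S\<^sub>4 P\<^sub>4 n Maxi (insert m E)"
      obtain s' where s': "step s s'" "I Maxi s'" using assms(2) less.prems(2) True Mini by blast
      obtain m where m: "m \<in> ?M" "rep n (insert m E) s'"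
        by (rule rep_step[OF less.prems(1) s'(1)])
      have "game_value S\<^sub>4 P\<^sub>4 n x E = Min (?g ` ?M)" using ns Mini by (subst game_value.simps) simp
      also have "\<dots> \<le> ?g m" by (intro Min_le finite_imageI finite_moves imageI m(1))
      also have "?g m + c \<le> n" using less.hyps[OF remaining_edges_decrease[OF m(1)] m(2) s'(2)] .
      finally show ?thesis by simp
    next
      case Maxi
      let ?g = "\<lambda>m. game_value S\<^sub>4 P\<^sub>4 n Mini (insert m E)"
      have "?M \<noteq> {}" using rep_step[OF less.prems(1)] True by blast
      then have "Max (?g ` ?M) \<in> ?g ` ?M" by (intro Max_in finite_imageI finite_moves) simp
      then obtain m where m: "m \<in> ?M" "Max (?g ` ?M) = ?g m" by blast
      obtain s' where s': "step s s'" "rep n (insert m E) s'"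
        by (rule rep_move[OF less.prems(1) m(1)])
      have "I Mini s'" using assms(1) less.prems(2) Maxi s'(1) by blast
      from less.hyps[OF remaining_edges_decrease[OF m(1)] s'(2) this]
      have "?g m + c \<le> n" .
      moreover have "game_value S\<^sub>4 P\<^sub>4 n x E = ?g m"
        using ns Maxi m(2) by (subst game_value.simps) simp
      ultimately show ?thesis by simp
    qed
  qed
qed

subsection \<open>Strategies\<close>

text \<open>Max joins a path on three vertices to another path whenever there is one, so a triangle
  can only be the last thing to arise. The loss is then 3; without a triangle, at most one short
  path remains and costs at most 2.\<close>

lemma max_strategy: "n \<le> game_value S\<^sub>4 P\<^sub>4 n x {} + 3"
proof -
  \<comment> \<open>Mini may face a path on three vertices only if no other path is left; the last
    disjunct is the end with one triangle.\<close>
  define I where "I x s \<longleftrightarrow> (case s of (i :: nat, e :: nat, p :: nat, q :: nat, t :: nat) \<Rightarrow>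
     t = 0 \<and> (p = 0 \<or> p = 1 \<and> (x = Maxi \<or> i = 0 \<and> e = 0 \<and> q = 0)) \<or>
     t = 1 \<and> i = 0 \<and> e = 0 \<and> p = 0 \<and> q = 0)" for x s
  show ?thesis
  proof (rule game_value_ge[of I])
    show "I Maxi s'" if "I Mini s" "step s s'" for s s'
      using that by (cases s) (auto simp: I_def step_iff)
    show "\<exists>s''. step s s'' \<and> I Mini s''" if "I Maxi s" "step s s'" for s s'
    proof -
      obtain i e p q t where s: "s = (i, e, p, q, t)" by (cases s)
      have "\<not> (i + e \<le> 1 \<and> p = 0 \<and> q = 0)"
        using that(2) stuck_iff[of i e p q t] unfolding s by blast
      moreover from this have "t = 0" and "p = 0 \<or> p = 1" using that(1) by (auto simp: I_def s)
      \<comment> \<open>Only with just one isolated vertex and one edge left must Max create a path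
        on three vertices himself.\<close>
      ultimately consider "p = 0" "2 \<le> i" | "p = 0" "2 \<le> e" | "p = 0" "1 \<le> q"
        | "p = 0" "i = 1" "e = 1" "q = 0"
        | "p = 1" "1 \<le> i" | "p = 1" "1 \<le> e" | "p = 1" "1 \<le> q" | "p = 1" "i = 0" "e = 0" "q = 0"
        by linarith
      then show ?thesis
        unfolding s ex_step by cases (use \<open>t = 0\<close> in \<open>simp_all add: I_def\<close>)
    qed
    show "cost s \<le> 3" if "I x s" "\<nexists>s'. step s s'" for x s
    proof -
      obtain i e p q t where s: "s = (i, e, p, q, t)" by (cases s)
      have "i + e \<le> 1" "p = 0" "q = 0" using that(2) unfolding s stuck_iff by simp_all
      with that(1) show ?thesis by (auto simp: I_def s)
    qed
    show "I x (n, 0, 0, 0, 0)" by (simp add: I_def)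
  qed (rule rep_empty)
qed

lemma game_value_le_n: "game_value S\<^sub>4 P\<^sub>4 n x {} \<le> n"
proof -
  have "game_value S\<^sub>4 P\<^sub>4 n x {} + 0 \<le> n"
  proof (rule game_value_le[of "\<lambda>_ _. True"])
    show "rep n {} (n, 0, 0, 0, 0)" by (rule rep_empty)
  qed blast+
  then show ?thesis by simp
qed

text \<open>Mini has won against a bound \<open>c \<le> 3\<close> as soon as there is a triangle or it is her turn and
  some path has three vertices, so a strategy needs to describe only the other positions: \<open>A\<close> and
  \<open>B\<close> with Max to move and zero or one path on three vertices, \<open>N\<close> with Mini to move.\<close>
lemma mini_strategy:
  fixes A B N :: "nat \<Rightarrow> nat \<Rightarrow> nat \<Rightarrow> bool"
  assumes c: "c \<le> 3"
    and stop: "\<And>i e. A i e 0 \<Longrightarrow> i + e \<le> 1 \<Longrightarrow> c \<le> i + 2 * e"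
    and A: "\<And>i e q. A (i + 2) e q \<Longrightarrow> N i (e + 1) q"
      "\<And>i e q. A (i + 1) e (q + 1) \<Longrightarrow> N i e (q + 1)"
      "\<And>i e q. A i (e + 2) q \<Longrightarrow> N i e (q + 1)"
      "\<And>i e q. A i (e + 1) (q + 1) \<Longrightarrow> N i e (q + 1)"
      "\<And>i e q. A i e (q + 1) \<Longrightarrow> N i e q"
    and B: "\<And>i e q. B (i + 1) e q \<Longrightarrow> N i e (q + 1)"
      "\<And>i e q. B i (e + 1) q \<Longrightarrow> N i e (q + 1)"
      "\<And>i e q. B i e (q + 1) \<Longrightarrow> N i e (q + 1)"
    and N: "\<And>i e q. N i e q \<Longrightarrow>
      q = 0 \<and> i + e \<le> 1 \<and> c \<le> i + 2 * e \<or>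
      2 \<le> i \<and> A (i - 2) (e + 1) q \<or>
      1 \<le> i \<and> 1 \<le> e \<and> B (i - 1) (e - 1) q \<or>
      1 \<le> i \<and> 1 \<le> q \<and> A (i - 1) e q \<or>
      1 \<le> e \<and> 1 \<le> q \<and> A i (e - 1) q \<or>
      1 \<le> q \<and> A i e (q - 1)"
    and init: "if x = Maxi then A n 0 0 else N n 0 0"
  shows "game_value S\<^sub>4 P\<^sub>4 n x {} + c \<le> n"
proof -
  define I where "I x s \<longleftrightarrow> (case s of (i, e, p, q, t) \<Rightarrow> 1 \<le> t \<or>
    (if x = Maxi then p = 0 \<and> A i e q \<or> p = 1 \<and> B i e q else 1 \<le> p \<or> N i e q))"
    for x and s :: "nat \<times> nat \<times> nat \<times> nat \<times> nat"
  show ?thesis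
  proof (rule game_value_le[of I])
    show "I Mini s'" if "I Maxi s" "step s s'" for s s'
    proof (cases "1 \<le> snd (snd (snd (snd s)))")
      case True
      with that(2) show ?thesis by cases (simp_all add: I_def)
    next
      case False
      \<comment> \<open>The steps of Max missing from the assumptions on \<open>A\<close> and
        \<open>B\<close> leave Mini a path on three vertices or a triangle, hence a position of
        \<open>I\<close> anyway.\<close>
      with that(2,1) show ?thesis
        by cases (use A B in \<open>auto simp: I_def\<close>)
    qed
    show "\<exists>s''. step s s'' \<and> I Maxi s''" if "I Mini s" "step s s'" for s s'
    proof -
      obtain i e p q t where s: "s = (i, e, p, q, t)" by (cases s)
      note IN = that(1)
      consider "1 \<le> t" | "1 \<le> p" | "t = 0" "p = 0" "N i e q"
        using IN by (cases t; cases p) (auto simp: s I_def)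
      then show ?thesis
      proof cases
        case 1
        \<comment> \<open>A triangle is never destroyed, so any step keeps the win.\<close>
        then have "I Maxi s'" using that(2) by (auto simp: s step_iff I_def)
        with that(2) show ?thesis by blast
      next
        case 2
        then have "step s (i, e, p - 1, q, t + 1)" by (simp add: s step_iff)
        then show ?thesis by (intro exI[of _ "(i, e, p - 1, q, t + 1)"]) (simp add: I_def)
      next
        case 3
        have "\<not> (q = 0 \<and> i + e \<le> 1)" using that(2) 3 by (auto simp: s step_iff)
        with N[OF 3(3)] show ?thesis unfolding s ex_step by (auto simp: I_def 3)
      qed
    qed
    show "c \<le> cost s" if "I x s" "\<nexists>s'. step s s'" for x s
    proof -
      obtain i e p q t where s: "s = (i, e, p, q, t)" by (cases s)
      have stuck: "q = 0" "p = 0" "i + e \<le> 1" using that(2) unfolding s stuck_iff by simp_all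
      have "c \<le> i + 2 * e" if "N i e 0" using N[OF that] stuck by auto
      then show ?thesis
        using that(1) stop stuck c by (cases t) (auto simp: I_def s split: if_splits)
    qed
    show "I x (n, 0, 0, 0, 0)" using init by (simp add: I_def)
  qed (rule rep_empty)
qed

section \<open>Strategies of Mini by the residue of n modulo 4\<close>

text \<open>The recursion makes the residue computable one successor at a time, as isolated vertices
  are used up.\<close>

fun mod4 :: "nat \<Rightarrow> nat" where
  "mod4 0 = 0"
| "mod4 (Suc i) = (if mod4 i = 3 then 0 else Suc (mod4 i))"

lemma mod4: "mod4 i = i mod 4"
  by (induction i) (auto simp: mod_Suc)

lemma nat_cases_2:
  obtains "i = 0" | "i = Suc 0" | j where "i = Suc (Suc j)"
  by (metis not0_implies_Suc)

text \<open>Each round turns four isolated vertices into a 4-cycle: Max must make an edge, Mini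
  extends it to three vertices, Max must add a fourth or lose a triangle, and Mini closes. So the
  residue persists, and the last \<open>r\<close> vertices end as an isolated vertex, an edge or a
  triangle.\<close>

lemma s1_mod4:
  assumes "mod4 n = r" "1 \<le> r"
  shows "s\<^sub>1 n P\<^sub>4 S\<^sub>4 + r \<le> n"
proof -
  have r: "r = 1 \<or> r = 2 \<or> r = 3" using assms mod4[of n] by auto
  show ?thesis
    unfolding s\<^sub>1_def
  proof (rule mini_strategy[where
      A = "\<lambda>i e q. e = 0 \<and> q = 0 \<and> mod4 i = r" and
      \<comment> \<open>Three vertices of the round are used by then, and r - 3 is r + 1 modulo
        4.\<close>
      B = "\<lambda>i e q. e = 0 \<and> q = 0 \<and> mod4 i = mod4 (r + 1)" and
      N = "\<lambda>i e q. e = 1 \<and> q = 0 \<and> mod4 (i + 2) = r \<or> e = 0 \<and> q = 1 \<and> mod4 i = r"],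
      goal_cases)
    case (2 i e)
    then show ?case using r by (cases i rule: nat_cases_2) auto
  next
    case (8 i e q)
    then show ?case using r by (auto simp: eval_nat_numeral split: if_splits)
  next
    case (11 i e q)
    with r show ?case by (cases i rule: nat_cases_2) (auto simp: eval_nat_numeral split: if_splits)
  qed (use assms r in \<open>auto simp: eval_nat_numeral split: if_splits\<close>)
qed

text \<open>The openings share their later positions, so one invariant serves both. Mini normally
  closes each long path at once. That must not leave Max four isolated vertices, or three and an
  edge, from which he loses nothing; there Mini extends the long path instead and reaches
  \<open>A 3 0 1\<close>.\<close>

lemma game_value_mod4_0_1:
  assumes "if x = Maxi then mod4 n = 0 \<and> n \<notin> {0, 4} else mod4 n = 1 \<and> n \<notin> {1, 5}"
  shows "game_value S\<^sub>4 P\<^sub>4 n x {} + 2 \<le> n"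
proof -
  define A where "A i e q \<longleftrightarrow> q = 0 \<and> e = 0 \<and> (i = 2 \<or> mod4 i = 0 \<and> i \<noteq> 0 \<and> i \<noteq> 4) \<or>
      q = 0 \<and> e = 1 \<and> (i = 1 \<or> mod4 i = 3 \<and> i \<noteq> 3) \<or> q = 1 \<and> e = 0 \<and> i = 3"
    for i e q :: nat
  define B where "B i e q \<longleftrightarrow> q = 0 \<and> (e = 0 \<and> mod4 i = 1 \<and> i \<noteq> 1 \<or> e = 1 \<and> mod4 i = 0 \<and> i \<noteq> 0)"
    for i e q :: nat
  define N where "N i e q \<longleftrightarrow> q = 0 \<and> (e = 0 \<and> (i = 3 \<or> mod4 i = 1 \<and> i \<noteq> 1 \<and> i \<noteq> 5) \<or>
        e = 1 \<and> (i = 0 \<or> mod4 i = 2 \<and> i \<noteq> 2) \<or> e = 2 \<and> mod4 i = 1 \<and> i \<noteq> 1) \<or>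
      q = 1 \<and> (e = 0 \<and> (i = 2 \<or> mod4 i = 0 \<and> i \<noteq> 0) \<or> e = 1 \<and> (i = 1 \<or> mod4 i = 3))"
    for i e q :: nat
  show ?thesis
  proof (rule mini_strategy[of _ A N B], goal_cases)
    case (2 i e)
    then show ?case
      by (cases i rule: nat_cases_2) (auto simp: A_def)
  next
    case (11 i e q)
    then show ?case
      unfolding N_def
      by (elim disjE conjE; simp)
        (cases i rule: nat_cases_2; auto simp: A_def B_def split: if_splits)+
  qed (use assms in \<open>auto simp: A_def B_def N_def split: if_splits\<close>)
qed

text \<open>Mini opens with an edge, later extends an edge to three vertices, and closes every long
  path. When Max moves, the isolated vertices number 1 modulo 4 without an edge or 0 modulo 4 beside
  one edge, so the paths never run out completely.\<close>

lemma s2_mod4_2: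
  assumes "mod4 n = 2 \<and> n \<noteq> 2"
  shows "s\<^sub>2 n P\<^sub>4 S\<^sub>4 + 1 \<le> n"
proof -
  define A where "A i e q \<longleftrightarrow> q = 0 \<and> (e = 0 \<and> mod4 i = 1 \<or> e = 1 \<and> mod4 i = 0)"
    for i e q :: nat
  define B where "B i e q \<longleftrightarrow> q = 0 \<and> (e = 0 \<and> mod4 i = 2 \<or> e = 1 \<and> mod4 i = 1)"
    for i e q :: nat
  define N where "N i e q \<longleftrightarrow> q = 0 \<and> (e = 0 \<and> mod4 i = 2 \<and> i \<noteq> 2 \<or> e = 1 \<and> mod4 i = 3 \<or> e = 2 \<and> mod4 i = 2) \<or>
      q = 1 \<and> (e = 0 \<and> mod4 i = 1 \<or> e = 1 \<and> mod4 i = 0)"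
    for i e q :: nat
  show ?thesis
    unfolding s\<^sub>2_def
  proof (rule mini_strategy[of _ A N B], goal_cases)
    case (2 i e)
    then show ?case
      by (cases i rule: nat_cases_2) (auto simp: A_def)
  next
    case (11 i e q)
    then show ?case
      unfolding N_def
      by (elim disjE conjE; simp)
        (cases i rule: nat_cases_2; auto simp: A_def B_def split: if_splits)+
  qed (use assms in \<open>auto simp: A_def B_def N_def split: if_splits\<close>)
qed

text \<open>The plan is again to close long paths at once. The exception is a long path beside two
  isolated vertices and an edge: closing it would let Max lose nothing, so Mini appends an isolated
  vertex and reaches \<open>A 1 1 1\<close>.\<close>

lemma s2_mod4_0:
  assumes "mod4 n = 0 \<and> n \<notin> {0, 4}"
  shows "s\<^sub>2 n P\<^sub>4 S\<^sub>4 + 1 \<le> n"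
proof -
  define A where "A i e q \<longleftrightarrow> q = 0 \<and> (e = 0 \<and> (i = 1 \<or> mod4 i = 3) \<or> e = 1 \<and> (i = 0 \<or> mod4 i = 2 \<and> i \<noteq> 2)) \<or>
      q = 1 \<and> e = 1 \<and> i = 1"
    for i e q :: nat
  define B where "B i e q \<longleftrightarrow> q = 0 \<and> (e = 0 \<and> mod4 i = 0 \<or> e = 1 \<and> mod4 i = 3)"
    for i e q :: nat
  define N where "N i e q \<longleftrightarrow> q = 0 \<and> (e = 0 \<and> mod4 i = 0 \<and> i \<noteq> 0 \<and> i \<noteq> 4 \<or> e = 1 \<and> mod4 i = 1 \<or>
        e = 2 \<and> mod4 i = 0 \<and> i \<noteq> 0) \<or>
      q = 1 \<and> (e = 0 \<and> (i = 1 \<or> mod4 i = 3) \<or> e = 1 \<and> (i = 0 \<or> mod4 i = 2))"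
    for i e q :: nat
  show ?thesis
    unfolding s\<^sub>2_def
  proof (rule mini_strategy[of _ A N B], goal_cases)
    case (2 i e)
    then show ?case
      by (cases i rule: nat_cases_2) (auto simp: A_def)
  next
    case (11 i e q)
    then show ?case
      unfolding N_def
      by (elim disjE conjE; simp)
        (cases i rule: nat_cases_2; auto simp: A_def B_def split: if_splits)+
  qed (use assms in \<open>auto simp: A_def B_def N_def split: if_splits\<close>)
qed

text \<open>Mini answers each new edge with another and closes each long path formed from two edges.
  Max then always faces an odd number of edges and 1 modulo 4 isolated vertices. The game cannot end
  there, and with one of each left he must create a path on three vertices, which becomes a
  triangle.\<close>

lemma s2_mod4_3:
  assumes "mod4 n = 3"
  shows "s\<^sub>2 n P\<^sub>4 S\<^sub>4 + 3 \<le> n"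
proof -
  define A where "A i e q \<longleftrightarrow> q = 0 \<and> (e = 0 \<and> mod4 i = 3 \<or> odd e \<and> mod4 i = 1)"
    for i e q :: nat
  define B where "B i e q \<longleftrightarrow> q = 0 \<and> e = 0 \<and> mod4 i = 0"
    for i e q :: nat
  define N where "N i e q \<longleftrightarrow> q = 0 \<and> (even e \<and> mod4 i = 3 \<or> e = 1 \<and> mod4 i = 1) \<or>
      q = 1 \<and> (e = 0 \<and> mod4 i = 3 \<or> odd e \<and> mod4 i = 1)"
    for i e q :: nat
  show ?thesis
    unfolding s\<^sub>2_def
  proof (rule mini_strategy[of _ A N B], goal_cases)
    case (2 i e)
    then show ?case
      by (cases i rule: nat_cases_2) (auto simp: A_def)
  next
    case (11 i e q)
    then show ?case
      unfolding N_def
      by (elim disjE conjE; simp)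
        (cases i rule: nat_cases_2; auto simp: A_def B_def split: if_splits)+
  qed (use assms in \<open>auto simp: A_def B_def N_def split: if_splits\<close>)
qed

lemma s2_small:
  assumes "n \<le> 2"
  shows "s\<^sub>2 n P\<^sub>4 S\<^sub>4 = 0"
proof -
  have "s\<^sub>2 n P\<^sub>4 S\<^sub>4 + n \<le> n"
    unfolding s\<^sub>2_def
    by (rule mini_strategy[where A = "\<lambda>i e q. i = 0 \<and> e = 1 \<and> q = 0 \<and> n = 2"
        and B = "\<lambda>_ _ _. False" and N = "\<lambda>i e q. i = n \<and> e = 0 \<and> q = 0"])
      (use assms in auto)
  then show ?thesis by simp
qed

lemma max_strategy_small:
  assumes "n = 4 \<or> x = Mini \<and> n = 5"
  shows "n \<le> game_value S\<^sub>4 P\<^sub>4 n x {}"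
proof -
  \<comment> \<open>These are the positions that the strategies of Max allow on four and five
    vertices. The only one without a step is the zero tuple, where every vertex lies on a long
    cycle.\<close>
  define I :: "player \<Rightarrow> nat \<times> nat \<times> nat \<times> nat \<times> nat \<Rightarrow> bool" where
    "I x s \<longleftrightarrow> s \<in> (case x of
       Maxi \<Rightarrow> {(4, 0, 0, 0, 0), (3, 1, 0, 0, 0), (2, 1, 0, 0, 0), (0, 2, 0, 0, 0), (1, 0, 1, 0, 0),
         (0, 1, 1, 0, 0), (1, 0, 0, 1, 0), (0, 0, 0, 1, 0), (0, 0, 0, 0, 0)}
     | Mini \<Rightarrow> {(5, 0, 0, 0, 0), (4, 0, 0, 0, 0), (2, 1, 0, 0, 0), (1, 2, 0, 0, 0), (0, 2, 0, 0, 0),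
         (0, 0, 0, 1, 0), (0, 0, 0, 0, 0)})" for x s
  have "n \<le> game_value S\<^sub>4 P\<^sub>4 n x {} + 0"
  proof (rule game_value_ge[of I])
    show "I Maxi s'" if "I Mini s" "step s s'" for s s'
      using that by (auto simp: I_def step_iff)
    show "\<exists>s''. step s s'' \<and> I Mini s''" if "I Maxi s" "step s s'" for s s'
      using that(1)[unfolded I_def player.case insert_iff empty_iff simp_thms]
    proof (elim disjE)
      assume "s = (0, 0, 0, 0, 0)"
      with that(2) show ?thesis by (simp add: step_iff)
    qed (simp_all add: ex_step I_def del: split_paired_Ex)
    show "cost s \<le> 0" if "I x s" "\<nexists>s'. step s s'" for x s
    proof -
      obtain i e p q t where s: "s = (i, e, p, q, t)" by (cases s)
      have "i + e \<le> 1" "p = 0" "q = 0" using that(2) unfolding s stuck_iff by simp_all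
      with that(1) show ?thesis by (cases x) (auto simp: I_def s)
    qed
    show "I x (n, 0, 0, 0, 0)" using assms by (cases x) (auto simp: I_def)
  qed (rule rep_empty)
  then show ?thesis by simp
qed

theorem theorem3p11:
  shows "(\<forall>n\<ge>1. int (s\<^sub>1 n P\<^sub>4 S\<^sub>4) \<ge> int n - 3 \<and> int (s\<^sub>2 n P\<^sub>4 S\<^sub>4) \<ge> int n - 3)
    \<and> int (s\<^sub>1 1 P\<^sub>4 S\<^sub>4) = 1 - 1
    \<and> int (s\<^sub>1 2 P\<^sub>4 S\<^sub>4) = 2 - 2
    \<and> int (s\<^sub>1 3 P\<^sub>4 S\<^sub>4) = 3 - 3
    \<and> int (s\<^sub>1 4 P\<^sub>4 S\<^sub>4) = 4
    \<and> int (s\<^sub>1 5 P\<^sub>4 S\<^sub>4) \<le> 5 - 1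
    \<and> int (s\<^sub>2 1 P\<^sub>4 S\<^sub>4) = 1 - 1
    \<and> int (s\<^sub>2 2 P\<^sub>4 S\<^sub>4) = 2 - 2
    \<and> int (s\<^sub>2 3 P\<^sub>4 S\<^sub>4) = 3 - 3
    \<and> int (s\<^sub>2 4 P\<^sub>4 S\<^sub>4) = 4
    \<and> int (s\<^sub>2 5 P\<^sub>4 S\<^sub>4) = 5
    \<and> (\<forall>k n :: nat.
         (n = 4 * k + 6 \<longrightarrow>
            int (s\<^sub>1 n P\<^sub>4 S\<^sub>4) \<le> int n - 2 \<and> int (s\<^sub>2 n P\<^sub>4 S\<^sub>4) \<le> int n - 1)
       \<and> (n = 4 * k + 7 \<longrightarrow>
            int (s\<^sub>1 n P\<^sub>4 S\<^sub>4) = int n - 3 \<and> int (s\<^sub>2 n P\<^sub>4 S\<^sub>4) = int n - 3)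
       \<and> (n = 4 * k + 8 \<longrightarrow>
            int (s\<^sub>1 n P\<^sub>4 S\<^sub>4) \<le> int n - 2 \<and> int (s\<^sub>2 n P\<^sub>4 S\<^sub>4) \<le> int n - 1)
       \<and> (n = 4 * k + 9 \<longrightarrow>
            int (s\<^sub>1 n P\<^sub>4 S\<^sub>4) \<le> int n - 1 \<and> int (s\<^sub>2 n P\<^sub>4 S\<^sub>4) \<le> int n - 2))"
proof -
  have max: "n \<le> s\<^sub>1 n P\<^sub>4 S\<^sub>4 + 3" "n \<le> s\<^sub>2 n P\<^sub>4 S\<^sub>4 + 3" for n
    using max_strategy by (simp_all add: s\<^sub>1_def s\<^sub>2_def)
  have small: "s\<^sub>1 4 P\<^sub>4 S\<^sub>4 = 4" "s\<^sub>2 4 P\<^sub>4 S\<^sub>4 = 4" "s\<^sub>2 5 P\<^sub>4 S\<^sub>4 = 5"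
    unfolding s\<^sub>1_def s\<^sub>2_def
    by (intro antisym game_value_le_n max_strategy_small; simp)+
  have mod: "mod4 (4 * k + 6) = 2" "mod4 (4 * k + 7) = 3" "mod4 (4 * k + 8) = 0" "mod4 (4 * k + 9) = 1"
    for k unfolding mod4 by presburger+
  \<comment> \<open>When Max starts, residues 1 to 3 fall under \<open>s1_mod4\<close>; each other
    case has the strategy for its residue.\<close>
  have k: "s\<^sub>1 (4 * k + 6) P\<^sub>4 S\<^sub>4 + 2 \<le> 4 * k + 6" "s\<^sub>2 (4 * k + 6) P\<^sub>4 S\<^sub>4 + 1 \<le> 4 * k + 6"
      "s\<^sub>1 (4 * k + 7) P\<^sub>4 S\<^sub>4 + 3 \<le> 4 * k + 7" "s\<^sub>2 (4 * k + 7) P\<^sub>4 S\<^sub>4 + 3 \<le> 4 * k + 7"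
      "s\<^sub>1 (4 * k + 8) P\<^sub>4 S\<^sub>4 + 2 \<le> 4 * k + 8" "s\<^sub>2 (4 * k + 8) P\<^sub>4 S\<^sub>4 + 1 \<le> 4 * k + 8"
      "s\<^sub>1 (4 * k + 9) P\<^sub>4 S\<^sub>4 + 1 \<le> 4 * k + 9" "s\<^sub>2 (4 * k + 9) P\<^sub>4 S\<^sub>4 + 2 \<le> 4 * k + 9" for k
    by (rule s1_mod4 s2_mod4_0 s2_mod4_2 s2_mod4_3 game_value_mod4_0_1[where x = Maxi, folded s\<^sub>1_def]
        game_value_mod4_0_1[where x = Mini, folded s\<^sub>2_def]; simp add: mod; fail)+
  have s1: "s\<^sub>1 1 P\<^sub>4 S\<^sub>4 + 1 \<le> 1" "s\<^sub>1 2 P\<^sub>4 S\<^sub>4 + 2 \<le> 2" "s\<^sub>1 3 P\<^sub>4 S\<^sub>4 + 3 \<le> 3"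
      "s\<^sub>1 5 P\<^sub>4 S\<^sub>4 + 1 \<le> 5"
    by (rule s1_mod4; simp add: mod4)+
  have s2: "s\<^sub>2 1 P\<^sub>4 S\<^sub>4 = 0" "s\<^sub>2 2 P\<^sub>4 S\<^sub>4 = 0" "s\<^sub>2 3 P\<^sub>4 S\<^sub>4 + 3 \<le> 3"
    using s2_small[of 1] s2_small[of 2] s2_mod4_3[of 3] by (simp_all add: mod4)
  have "(n = 4 * k + 6 \<longrightarrow>
            int (s\<^sub>1 n P\<^sub>4 S\<^sub>4) \<le> int n - 2 \<and> int (s\<^sub>2 n P\<^sub>4 S\<^sub>4) \<le> int n - 1)
       \<and> (n = 4 * k + 7 \<longrightarrow>
            int (s\<^sub>1 n P\<^sub>4 S\<^sub>4) = int n - 3 \<and> int (s\<^sub>2 n P\<^sub>4 S\<^sub>4) = int n - 3)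
       \<and> (n = 4 * k + 8 \<longrightarrow>
            int (s\<^sub>1 n P\<^sub>4 S\<^sub>4) \<le> int n - 2 \<and> int (s\<^sub>2 n P\<^sub>4 S\<^sub>4) \<le> int n - 1)
       \<and> (n = 4 * k + 9 \<longrightarrow>
            int (s\<^sub>1 n P\<^sub>4 S\<^sub>4) \<le> int n - 1 \<and> int (s\<^sub>2 n P\<^sub>4 S\<^sub>4) \<le> int n - 2)" for k n
    using max[of n] k[of k] by (intro conjI impI; hypsubst; linarith)
  moreover have "int n - 3 \<le> int (s\<^sub>1 n P\<^sub>4 S\<^sub>4) \<and> int n - 3 \<le> int (s\<^sub>2 n P\<^sub>4 S\<^sub>4)" for n
    using max[of n] by linarith
  ultimately show ?thesis using small s1 s2 by simp
qed

end
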